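(* Let $f:\mathbb R\to\mathbb R$ be Lipschitz with $\zeta_0(f)=\mathbb E[f(\mathcal N)]=0$. For each $n$ let $u\in\mathbb R^n$ be a centered Gaussian vector with covariance matrix $S\in\mathbb R^{n\times n}$, let $y=f(u)$ (with $f$ applied entrywise), $\Sigma=\mathbb E[yy^\top]$ and $\Delta=S-I_n$. Assume that, as $n\to\infty$, $|||\Delta|||$ and $\|\vec{\mathrm{diag}}(\Delta)\|$ are bounded and $\|\Delta\|_{\max}$ converges to $0$. Let $$\Sigma_{\mathrm{approx}}=\|f\|_{\mathcal H}^2I_n+\frac{\zeta_2(f)^2}2\,\vec{\mathrm{diag}}(\Delta)\,\vec{\mathrm{diag}}(\Delta)^\top+\sum_{r=1}^3\zeta_r(f)^2\Delta^{\circ r}.$$ Then $|||\Sigma-\Sigma_{\mathrm{approx}}|||\le O(\|\Delta\|_{\max})$.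
   Context: $\|\cdot\|$ is the Euclidean norm, $|||\cdot|||$ the spectral norm, $\|\cdot\|_{\max}$ the entrywise maximum norm. $\Delta^{\circ r}$ is the entrywise (Hadamard) $r$-th power; $\vec{\mathrm{diag}}(\Delta)\in\mathbb R^n$ is the vector of diagonal entries. $\mathcal N$ is a standard Gaussian variable; $\|f\|_{\mathcal H}^2=\mathbb E[f(\mathcal N)^2]$; $\zeta_r(f)=\mathbb E[f(\mathcal N)h_r(\mathcal N)]/\sqrt{r!}$ with the Hermite polynomials $h_r(t)=(-1)^re^{t^2/2}\frac{d^r}{dt^r}e^{-t^2/2}$. *)

theory Defs
  imports "HOL-Probability.Probability" "Jordan_Normal_Form.Matrix"
begin

text \<open>The dimension tends to infinity, so vectors and matrices are those of \<^theory>\<open>Jordan_Normal_Form.Matrix\<close>,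
  which carry their dimension as a value. That theory provides no norms.\<close>

definition euclid_norm :: "real Matrix.vec \<Rightarrow> real" where
  "euclid_norm v = sqrt (scalar_prod v v)"

definition spectral_norm :: "real Matrix.mat \<Rightarrow> real" where
  "spectral_norm A =
     (SUP v \<in> {v \<in> carrier_vec (dim_col A). euclid_norm v \<le> 1}. euclid_norm (mult_mat_vec A v))"

text \<open>Unspecified for a matrix without entries.\<close>

definition max_norm :: "real Matrix.mat \<Rightarrow> real" where
  "max_norm A = Max (abs ` elements_mat A)"

definition hadamard_power :: "real Matrix.mat \<Rightarrow> nat \<Rightarrow> real Matrix.mat" where
  "hadamard_power A r = map_mat (\<lambda>x. x ^ r) A"

definition diag_vec :: "real Matrix.mat \<Rightarrow> real Matrix.vec" where
  "diag_vec A = vec_of_list (diag_mat A)"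

definition outer_prod :: "real Matrix.vec \<Rightarrow> real Matrix.vec \<Rightarrow> real Matrix.mat" where
  "outer_prod v w = Matrix.mat (dim_vec v) (dim_vec w) (\<lambda>(i, j). vec_index v i * vec_index w j)"

text \<open>Constants count as Gaussian (variance zero), so that singular covariance matrices are allowed.\<close>

definition gaussian_variable :: "'a measure \<Rightarrow> ('a \<Rightarrow> real) \<Rightarrow> bool" where
  "gaussian_variable M X \<longleftrightarrow>
     X \<in> borel_measurable M \<and>
     ((\<exists>\<mu>. AE \<omega> in M. X \<omega> = \<mu>) \<or>
      (\<exists>\<mu> \<sigma>. \<sigma> > 0 \<and> distributed M lborel X (normal_density \<mu> \<sigma>)))"

definition gaussian_vector :: "'a measure \<Rightarrow> nat \<Rightarrow> ('a \<Rightarrow> real Matrix.vec) \<Rightarrow> bool" where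
  "gaussian_vector M n X \<longleftrightarrow>
     prob_space M \<and>
     (\<forall>\<omega>\<in>space M. X \<omega> \<in> carrier_vec n) \<and>
     (\<forall>c\<in>carrier_vec n. gaussian_variable M (\<lambda>\<omega>. scalar_prod c (X \<omega>)))"

definition mean_vec :: "'a measure \<Rightarrow> nat \<Rightarrow> ('a \<Rightarrow> real Matrix.vec) \<Rightarrow> real Matrix.vec" where
  "mean_vec M n X = Matrix.vec n (\<lambda>i. \<integral>\<omega>. vec_index (X \<omega>) i \<partial>M)"

definition second_moment_mat :: "'a measure \<Rightarrow> nat \<Rightarrow> ('a \<Rightarrow> real Matrix.vec) \<Rightarrow> real Matrix.mat" where
  "second_moment_mat M n X =
     Matrix.mat n n (\<lambda>(i, j). \<integral>\<omega>. vec_index (X \<omega>) i * vec_index (X \<omega>) j \<partial>M)"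

definition covariance_mat :: "'a measure \<Rightarrow> nat \<Rightarrow> ('a \<Rightarrow> real Matrix.vec) \<Rightarrow> real Matrix.mat" where
  "covariance_mat M n X = second_moment_mat M n (\<lambda>\<omega>. X \<omega> - mean_vec M n X)"

definition hermite :: "nat \<Rightarrow> real \<Rightarrow> real" where
  "hermite r t = (-1) ^ r * exp (t\<^sup>2 / 2) * (deriv ^^ r) (\<lambda>s. exp (- s\<^sup>2 / 2)) t"

definition zeta :: "nat \<Rightarrow> (real \<Rightarrow> real) \<Rightarrow> real" where
  "zeta r f = (\<integral>t. f t * hermite r t \<partial>std_normal_distribution) / sqrt (fact r)"

definition H_norm :: "(real \<Rightarrow> real) \<Rightarrow> real" where
  "H_norm f = sqrt (\<integral>t. (f t)\<^sup>2 \<partial>std_normal_distribution)"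

definition Sigma_approx :: "(real \<Rightarrow> real) \<Rightarrow> nat \<Rightarrow> real Matrix.mat \<Rightarrow> real Matrix.mat" where
  "Sigma_approx f n \<Delta> =
     (H_norm f)\<^sup>2 \<cdot>\<^sub>m 1\<^sub>m n
     + ((zeta 2 f)\<^sup>2 / 2) \<cdot>\<^sub>m outer_prod (diag_vec \<Delta>) (diag_vec \<Delta>)
     + ((zeta 1 f)\<^sup>2 \<cdot>\<^sub>m hadamard_power \<Delta> 1
        + (zeta 2 f)\<^sup>2 \<cdot>\<^sub>m hadamard_power \<Delta> 2
        + (zeta 3 f)\<^sup>2 \<cdot>\<^sub>m hadamard_power \<Delta> 3)"

end

theory Submission
  imports Defs
begin

text \<open>
  Off the diagonal, standardize \<open>u\<^sub>i = \<sigma> X\<close> and \<open>u\<^sub>j = \<tau> (\<rho> X + sqrt (1 - \<rho>\<^sup>2) Z)\<close> with \<open>X, Z\<close>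
  independent standard Gaussians. Integrating out \<open>Z\<close> against the Mehler kernel, whose expansion
  in \<open>\<rho>\<close> is needed only up to an \<open>O(\<bar>\<rho>\<bar>\<^sup>3)\<close> remainder with Gaussian-integrable growth, gives
  \<open>\<Sigma>\<^sub>i\<^sub>j = p\<^sub>i p\<^sub>j + q\<^sub>i q\<^sub>j \<Delta>\<^sub>i\<^sub>j + \<zeta>\<^sub>2\<^sup>2 \<Delta>\<^sub>i\<^sub>j\<^sup>2 + O(\<epsilon> \<Delta>\<^sub>i\<^sub>j\<^sup>2)\<close>, where \<open>\<epsilon>\<close> is the maximum norm of \<open>\<Delta>\<close>.
  Here \<open>p\<^sub>i = E f(u\<^sub>i)\<close> equals \<open>\<zeta>\<^sub>2 \<Delta>\<^sub>i\<^sub>i / sqrt 2 + O(\<Delta>\<^sub>i\<^sub>i\<^sup>2)\<close> and \<open>q\<^sub>i = \<zeta>\<^sub>1 + O(\<epsilon>)\<close>, so the first two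
  terms are rank-one and diagonally rescaled perturbations of their counterparts in the approximation.
  The rest, including the \<open>\<zeta>\<^sub>3\<close> term, has entries \<open>O(\<epsilon> (\<Delta>\<^sub>i\<^sub>j\<^sup>2 + [i = j]))\<close>; since
  the row sums of \<open>\<Delta>\<^sub>i\<^sub>j\<^sup>2\<close> are at most the squared spectral norm of \<open>\<Delta>\<close>, Schur's test bounds it by \<open>O(\<epsilon>)\<close>.
\<close>

subsection \<open>Joint laws from characteristic functions\<close>

text \<open>As f is only Lipschitz, there is no second derivative of f to expand in. Wherever more
  than first-order accuracy is required, a change of variables moves the parameter from the argument
  of f into the Gaussian density, which depends on it smoothly. The accuracy demanded of each term
  is dictated by the operator norm, whose bound must not grow with n. The mean p_i must match its
  linear part up to Delta_ii^2, because Delta_ii^2 is at most \<epsilon> |Delta_ii| and the spare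
  factor |Delta_ii| is square summable over i with a bound free of n. For q_i an error of order
  \<epsilon> is enough, since q_i rescales a matrix of bounded operator norm. Off the diagonal,
  remainders known only to be of order \<epsilon>^3 could still add up to n \<epsilon>^3, so the
  cubic remainder of the Mehler kernel is kept as \<epsilon> Delta_ij^2. On the diagonal the
  correlation is 1 and that expansion is useless; there E f(u_i)^2 is compared with the identity
  term alone, all other terms being of order \<epsilon>.\<close>

lemma weighted_char_determines_distribution:
  fixes X w :: "'a \<Rightarrow> real"
  assumes "prob_space M" and [measurable]: "X \<in> borel_measurable M" "w \<in> borel_measurable M"
    and w0: "\<And>x. 0 \<le> w x" and wint: "integrable M w" and m: "(\<integral>x. w x \<partial>M) = m" "m > 0"
    and "prob_space N" and [measurable_cong]: "sets N = sets borel"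
    and ch: "\<And>s. (CLINT x|M. w x * iexp (s * X x)) = m * char N s"
    and A[measurable]: "A \<in> sets borel"
  shows "(\<integral>x. w x * indicator A (X x) \<partial>M) = m * measure N A"
proof -
  interpret prob_space M by fact
  \<comment> \<open>Tilting \<open>M\<close> by the normalized weight gives a probability measure
    under which \<open>X\<close> has the characteristic function of \<open>N\<close>; the
    one-dimensional uniqueness theorem then applies.\<close>
  define D where "D = density M (\<lambda>x. ennreal (w x / m))"
  have [measurable_cong]: "sets D = sets M" by (simp add: D_def)
  have "emeasure D (space D) = (\<integral>\<^sup>+x. ennreal (w x / m) \<partial>M)"
    unfolding D_def by (subst emeasure_density) (auto intro!: nn_integral_cong)
  also have "\<dots> = ennreal (\<integral>x. w x / m \<partial>M)"
    using wint w0 m by (intro nn_integral_eq_integral) auto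
  also have "\<dots> = 1" using m by simp
  finally have D: "prob_space D" by (rule prob_spaceI)
  then interpret D: prob_space D .
  have eq: "distr D borel X = N"
  proof (rule Levy_uniqueness)
    show "real_distribution (distr D borel X)"
      by (rule D.real_distribution_distr) simp
    show "real_distribution N"
      using assms(8) by (simp add: real_distribution_def real_distribution_axioms_def assms(9))
    show "char (distr D borel X) = char N"
    proof
      fix s
      have "char (distr D borel X) s = (CLINT x|D. iexp (s * X x))"
        unfolding char_def by (subst integral_distr) auto
      also have "\<dots> = (CLINT x|M. (w x / m) *\<^sub>R iexp (s * X x))"
        unfolding D_def using w0 m by (subst integral_density) auto
      also have "\<dots> = (CLINT x|M. (1/m) *\<^sub>R (w x * iexp (s * X x)))"
        by (intro Bochner_Integration.integral_cong) (auto simp: scaleR_conv_of_real)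
      also have "\<dots> = char N s" using ch[of s] m by (simp add: scaleR_conv_of_real)
      finally show "char (distr D borel X) s = char N s" .
    qed
  qed
  have "measure N A = measure D (X -` A \<inter> space D)"
    unfolding eq[symmetric] by (subst measure_distr) auto
  also have "\<dots> = (\<integral>x. indicator (X -` A \<inter> space D) x \<partial>D)" by simp
  also have "\<dots> = (\<integral>x. indicator A (X x) \<partial>D)"
    by (intro Bochner_Integration.integral_cong) (auto simp: indicator_def)
  also have "\<dots> = (\<integral>x. (w x / m) *\<^sub>R indicator A (X x) \<partial>M)"
    unfolding D_def using w0 m by (subst integral_density) auto
  also have "\<dots> = (\<integral>x. w x * indicator A (X x) \<partial>M) / m" by simp
  finally show ?thesis using m by simp
qed

text \<open>Two one-dimensional uniqueness arguments replace a two-dimensional one. Weighting by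
  functions of \<open>Z\<close> yields the mixed transform of an indicator in \<open>X\<close> and
  an exponential in \<open>Z\<close>; this transform, with the indicator as the weight, then
  determines \<open>Z\<close> on each event.\<close>

lemma joint_distribution_of_char_factorization:
  fixes X Z :: "'a \<Rightarrow> real"
  assumes "prob_space M" and [measurable]: "X \<in> borel_measurable M" "Z \<in> borel_measurable M"
    and P: "prob_space P" and [measurable_cong]: "sets P = sets borel"
    and Q: "prob_space Q" and [measurable_cong]: "sets Q = sets borel"
    and ch: "\<And>s t. (CLINT x|M. iexp (s * X x + t * Z x)) = char P s * char Q t"
  shows "distr M (P \<Otimes>\<^sub>M Q) (\<lambda>x. (X x, Z x)) = P \<Otimes>\<^sub>M Q"
proof -
  interpret prob_space M by fact
  interpret P: prob_space P by fact
  interpret Q: prob_space Q by fact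
  have bdd: "integrable M g" if "\<And>x. norm (g x) \<le> B" "g \<in> borel_measurable M"
    for g :: "'a \<Rightarrow> 'b::{banach, second_countable_topology}" and B
    using that by (intro integrable_const_bound[where B = B]) auto
  have [simp]: "char P 0 = 1" "char Q 0 = 1"
    by (simp_all add: char_def P.prob_space Q.prob_space)
  have X: "(\<integral>x. indicator A (X x) \<partial>M) = measure P A" if [measurable]: "A \<in> sets borel" for A
  proof -
    have "(CLINT x|M. iexp (s * X x)) = char P s" for s using ch[of s 0] by simp
    then show ?thesis
      using weighted_char_determines_distribution[of M X "\<lambda>_. 1" 1 P A] assms(1) P that
      by (simp add: prob_space assms(5))
  qed
  \<comment> \<open>Levy's theorem concerns measures, hence positive weights: \<open>2 + cos\<close> stands in for the
    real and imaginary parts of \<open>iexp (t * Z)\<close>.\<close>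
  have trig: "(\<integral>x. indicator A (X x) * cos (t * Z x - \<theta>) \<partial>M)
       = measure P A * (\<integral>x. cos (t * Z x - \<theta>) \<partial>M)" if [measurable]: "A \<in> sets borel" for A t \<theta>
  proof -
    define w where "w = (\<lambda>x. 2 + cos (t * Z x - \<theta>))"
    \<comment> \<open>The total mass of \<open>w\<close>: the constant 2 and the two exponential
      halves of the cosine, each evaluated by \<open>ch\<close> at s = 0.\<close>
    define c where "c = 2 + exp (- \<i> * \<theta>) / 2 * char Q t + exp (\<i> * \<theta>) / 2 * char Q (- t)"
    have [measurable]: "w \<in> borel_measurable M" by (simp add: w_def)
    have cosb: "- 1 \<le> cos y" "cos y \<le> 1" for y :: real by auto
    have w1: "1 \<le> w x" for x using cosb(1)[of "t * Z x - \<theta>"] unfolding w_def by linarith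
    have w3: "norm (w x) \<le> 3" for x using cosb[of "t * Z x - \<theta>"] unfolding w_def real_norm_def by linarith
    have wi: "integrable M w" using w3 by (rule bdd) simp
    have wc: "(CLINT x|M. w x * iexp (s * X x)) = c * char P s" for s
    proof -
      have int: "integrable M (\<lambda>x. iexp (s * X x + r * Z x))" for r
        by (rule bdd[of _ 1]) auto
      have lin: "(CLINT x|M. a * f x + b * g x + d * h x)
          = a * (CLINT x|M. f x) + b * (CLINT x|M. g x) + d * (CLINT x|M. h x)"
        if "integrable M f" "integrable M g" "integrable M h" for f g h :: "'a \<Rightarrow> complex" and a b d
        using that by simp
      have "w x * iexp (s * X x) = 2 * iexp (s * X x + 0 * Z x)
         + exp (- \<i> * \<theta>) / 2 * iexp (s * X x + t * Z x) + exp (\<i> * \<theta>) / 2 * iexp (s * X x + (-t) * Z x)" for x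
        unfolding w_def of_real_add cos_of_real[symmetric] cos_exp_eq
        by (simp add: algebra_simps exp_add exp_diff exp_minus field_simps)
      then have "(CLINT x|M. w x * iexp (s * X x)) = (CLINT x|M. 2 * iexp (s * X x + 0 * Z x)
         + exp (- \<i> * \<theta>) / 2 * iexp (s * X x + t * Z x) + exp (\<i> * \<theta>) / 2 * iexp (s * X x + (-t) * Z x))"
        by simp
      also have "\<dots> = 2 * (CLINT x|M. iexp (s * X x + 0 * Z x))
         + exp (- \<i> * \<theta>) / 2 * (CLINT x|M. iexp (s * X x + t * Z x))
         + exp (\<i> * \<theta>) / 2 * (CLINT x|M. iexp (s * X x + (-t) * Z x))"
        using lin[OF int int int] .
      also have "\<dots> = c * char P s" unfolding ch c_def by (simp add: algebra_simps)
      finally show ?thesis .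
    qed
    have m: "complex_of_real (\<integral>x. w x \<partial>M) = c" using wc[of 0] by simp
    have "(\<integral>x. 1 \<partial>M) \<le> (\<integral>x. w x \<partial>M)" using w1 wi by (intro integral_mono) auto
    then have "(\<integral>x. w x \<partial>M) > 0" by (simp add: prob_space)
    then have "(\<integral>x. w x * indicator A (X x) \<partial>M) = (\<integral>x. w x \<partial>M) * measure P A"
      using assms(1) w1 wi P wc m
      by (intro weighted_char_determines_distribution)
         (auto intro: order_trans[OF zero_le_one] simp: assms(5))
    moreover have "integrable M (\<lambda>x. cos (t * Z x - \<theta>))" by (rule bdd[of _ 1]) auto
    moreover have "integrable M (\<lambda>x. indicator A (X x) * cos (t * Z x - \<theta>))"
      by (rule bdd[of _ 1]) (auto simp: indicator_def)
    moreover have "integrable M (\<lambda>x. indicator A (X x) :: real)"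
      by (rule bdd[of _ 1]) (auto simp: indicator_def)
    ultimately show ?thesis using X[OF that]
      by (simp add: w_def prob_space algebra_simps)
  qed
  \<comment> \<open>The sine is a cosine shifted by pi / 2, so \<open>trig\<close> at the two phases
    0 and pi / 2 covers the complex exponential.\<close>
  have cs: "iexp y = cos y + \<i> * cos (y - pi / 2)" for y :: real
    by (simp add: cos_diff cis_conv_exp[symmetric] complex_eq_iff)
  have half: "(CLINT x|M. complex_of_real (indicator A (X x)) * iexp (t * Z x)) = measure P A * char Q t"
    if [measurable]: "A \<in> sets borel" for A t
  proof -
    have i1: "integrable M (\<lambda>x. cos (t * Z x - \<theta>))" for \<theta> by (rule bdd[of _ 1]) auto
    have i2: "integrable M (\<lambda>x. indicator A (X x) * cos (t * Z x - \<theta>))" for \<theta>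
      by (rule bdd[of _ 1]) (auto simp: indicator_def)
    have *: "(CLINT x|M. complex_of_real (g x) + \<i> * complex_of_real (h x))
        = complex_of_real (\<integral>x. g x \<partial>M) + \<i> * complex_of_real (\<integral>x. h x \<partial>M)" if "integrable M g" "integrable M h" for g h
      using that by simp
    have "complex_of_real a * iexp y = complex_of_real (a * cos (y - 0)) + \<i> * complex_of_real (a * cos (y - pi/2))"
      for a y :: real
      by (subst cs) (simp add: distrib_left mult.left_commute)
    then have "(CLINT x|M. complex_of_real (indicator A (X x)) * iexp (t * Z x))
        = (CLINT x|M. complex_of_real (indicator A (X x) * cos (t * Z x - 0))
            + \<i> * complex_of_real (indicator A (X x) * cos (t * Z x - pi/2)))"
      by (simp only:)
    also have "\<dots> = complex_of_real (\<integral>x. indicator A (X x) * cos (t * Z x - 0) \<partial>M)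
        + \<i> * complex_of_real (\<integral>x. indicator A (X x) * cos (t * Z x - pi/2) \<partial>M)"
      by (rule *[OF i2 i2])
    also have "\<dots> = measure P A * (complex_of_real (\<integral>x. cos (t * Z x - 0) \<partial>M) + \<i> * complex_of_real (\<integral>x. cos (t * Z x - pi/2) \<partial>M))"
      unfolding trig[OF that] by (simp add: algebra_simps)
    also have "\<dots> = measure P A * (CLINT x|M. iexp (t * Z x))"
      unfolding *[OF i1[of 0] i1[of "pi/2"], symmetric] cs by simp
    also have "\<dots> = measure P A * char Q t" using ch[of 0 t] by simp
    finally show ?thesis .
  qed
  \<comment> \<open>Now the weight is the indicator of \<open>X \<in> A\<close>: conditionally on this event, \<open>Z\<close> still has law \<open>Q\<close>.\<close>
  have prod: "(\<integral>x. indicator A (X x) * indicator B (Z x) \<partial>M) = measure P A * measure Q B"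
    if [measurable]: "A \<in> sets borel" "B \<in> sets borel" for A B
  proof (cases "measure P A = 0")
    \<comment> \<open>A weight of total mass zero cannot be normalized, so null events are settled
      directly: both sides vanish.\<close>
    case True
    have iA: "integrable M (\<lambda>x. indicator A (X x) :: real)"
      by (rule bdd[of _ 1]) (auto simp: indicator_def)
    have iB: "integrable M (\<lambda>x. indicator A (X x) * indicator B (Z x) :: real)"
      by (rule bdd[of _ 1]) (auto simp: indicator_def)
    have "(\<integral>x. indicator A (X x) * indicator B (Z x) \<partial>M) \<le> (\<integral>x. indicator A (X x) \<partial>M :: real)"
      by (intro integral_mono iA iB) (auto simp: indicator_def)
    moreover have "0 \<le> (\<integral>x. indicator A (X x) * indicator B (Z x) \<partial>M :: real)"
      by (intro integral_nonneg_AE) auto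
    ultimately show ?thesis using X[OF that(1)] True by simp
  next
    case False
    then have "measure P A > 0" by (simp add: zero_less_measure_iff)
    moreover have "integrable M (\<lambda>x. indicator A (X x) :: real)"
      by (rule bdd[of _ 1]) (auto simp: indicator_def)
    ultimately show ?thesis
      by (intro weighted_char_determines_distribution[OF assms(1,3) _ _ _ X[OF that(1)] _ Q assms(7) half[OF that(1)] that(2)])
         auto
  qed
  show ?thesis
  proof (rule pair_measure_eqI[symmetric])
    show "sigma_finite_measure P" "sigma_finite_measure Q" by unfold_locales
    fix A B assume AB: "A \<in> sets P" "B \<in> sets Q"
    then have [measurable]: "A \<in> sets borel" "B \<in> sets borel" by (simp_all add: assms)
    have "emeasure (distr M (P \<Otimes>\<^sub>M Q) (\<lambda>x. (X x, Z x))) (A \<times> B)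
        = emeasure M ((\<lambda>x. (X x, Z x)) -` (A \<times> B) \<inter> space M)"
      using AB by (subst emeasure_distr) auto
    also have "\<dots> = (\<integral>x. indicator ((\<lambda>x. (X x, Z x)) -` (A \<times> B) \<inter> space M) x \<partial>M)"
      by (simp add: emeasure_eq_measure)
    also have "(\<integral>x. indicator ((\<lambda>x. (X x, Z x)) -` (A \<times> B) \<inter> space M) x \<partial>M)
        = (\<integral>x. indicator A (X x) * indicator B (Z x) \<partial>M :: real)"
      by (intro Bochner_Integration.integral_cong) (auto simp: indicator_def)
    also have "\<dots> = measure P A * measure Q B" by (rule prod) auto
    finally show "emeasure P A * emeasure Q B = emeasure (distr M (P \<Otimes>\<^sub>M Q) (\<lambda>x. (X x, Z x))) (A \<times> B)"
      by (simp add: P.emeasure_eq_measure Q.emeasure_eq_measure ennreal_mult)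
  qed simp
qed

subsection \<open>Gaussian variables\<close>

abbreviation "\<gamma> \<equiv> std_normal_distribution"

lemma prob_space_std_normal: "prob_space \<gamma>"
  using real_dist_normal_dist by (simp add: real_distribution_def)

lemma abs_mult_le_sum_squares: "\<bar>a * b\<bar> \<le> a\<^sup>2 + b\<^sup>2" for a b :: real
proof -
  have "2 * (\<bar>a\<bar> * \<bar>b\<bar>) \<le> a\<^sup>2 + b\<^sup>2" using sum_squares_bound[of "\<bar>a\<bar>" "\<bar>b\<bar>"] by simp
  moreover have "0 \<le> \<bar>a\<bar> * \<bar>b\<bar>" by simp
  ultimately show ?thesis unfolding abs_mult by linarith
qed

text \<open>A \<open>gaussian_vector\<close> has values of the right dimension only on the sample
  space, so a scalar product equals the matching combination of coordinates only there.\<close>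

lemma gaussian_variable_cong:
  assumes "\<And>\<omega>. \<omega> \<in> space M \<Longrightarrow> g \<omega> = h \<omega>"
  shows "gaussian_variable M g \<longleftrightarrow> gaussian_variable M h"
proof -
  have "g \<in> borel_measurable M \<longleftrightarrow> h \<in> borel_measurable M" using assms by (rule measurable_cong)
  moreover have "(AE \<omega> in M. g \<omega> = \<mu>) \<longleftrightarrow> (AE \<omega> in M. h \<omega> = \<mu>)" for \<mu>
    using assms by (intro AE_cong) auto
  moreover have "distr M lborel g = distr M lborel h" using assms by (intro distr_cong) auto
  ultimately show ?thesis by (simp add: gaussian_variable_def distributed_def)
qed

lemma gaussian_variable_square_integrable:
  assumes "prob_space M" and G: "gaussian_variable M X"
  shows "integrable M (\<lambda>x. (X x)\<^sup>2)"
proof -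
  interpret prob_space M by fact
  have [measurable]: "X \<in> borel_measurable M" using G by (simp add: gaussian_variable_def)
  consider \<mu> where "AE x in M. X x = \<mu>"
    | \<mu> \<sigma> where "\<sigma> > 0" "distributed M lborel X (normal_density \<mu> \<sigma>)"
    using G by (auto simp: gaussian_variable_def)
  then show ?thesis
  proof cases
    case (1 \<mu>)
    then have "AE x in M. norm ((X x)\<^sup>2) \<le> \<mu>\<^sup>2" by eventually_elim simp
    then show ?thesis by (intro integrable_const_bound[where B = "\<mu>\<^sup>2"]) auto
  next
    case (2 \<mu> \<sigma>)
    have "integrable lborel (\<lambda>x. normal_density \<mu> \<sigma> x * (x - \<mu>)^2 + 2 * \<mu> * (normal_density \<mu> \<sigma> x * x)
        - \<mu>\<^sup>2 * normal_density \<mu> \<sigma> x)"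
      using 2(1) by (intro Bochner_Integration.integrable_add Bochner_Integration.integrable_diff
        integrable_mult_right integrable_normal_moment integrable_normal_moment_nz_1 integrable_normal_density)
    also have "(\<lambda>x. normal_density \<mu> \<sigma> x * (x - \<mu>)^2 + 2 * \<mu> * (normal_density \<mu> \<sigma> x * x)
        - \<mu>\<^sup>2 * normal_density \<mu> \<sigma> x) = (\<lambda>x. normal_density \<mu> \<sigma> x * x\<^sup>2)"
      by (auto simp: power2_eq_square algebra_simps)
    finally show ?thesis
      by (subst distributed_integrable[OF 2(2), of "\<lambda>x. x\<^sup>2", symmetric]) auto
  qed
qed

lemma gaussian_variable_char:
  assumes "prob_space M" and G: "gaussian_variable M X"
    and mean: "(\<integral>x. X x \<partial>M) = 0" and var: "(\<integral>x. (X x)\<^sup>2 \<partial>M) = v"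
  shows "(CLINT x|M. iexp (X x)) = exp (- v / 2)"
proof -
  interpret prob_space M by fact
  have [measurable]: "X \<in> borel_measurable M" using G by (simp add: gaussian_variable_def)
  consider \<mu> where "AE x in M. X x = \<mu>"
    | \<mu> \<sigma> where "\<sigma> > 0" "distributed M lborel X (normal_density \<mu> \<sigma>)"
    using G by (auto simp: gaussian_variable_def)
  then show ?thesis
  proof cases
    case (1 \<mu>)
    \<comment> \<open>Degenerate case: a constant of mean zero vanishes, so \<open>v\<close> is 0
      and both sides are 1.\<close>
    have "(\<integral>x. X x \<partial>M) = (\<integral>x. \<mu> \<partial>M)" using 1 by (intro integral_cong_AE) auto
    then have [simp]: "\<mu> = 0" using mean by (simp add: prob_space)
    have "(\<integral>x. (X x)\<^sup>2 \<partial>M) = (\<integral>x. 0 \<partial>M)" using 1 by (intro integral_cong_AE) auto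
    then have "v = 0" using var by simp
    moreover have "(CLINT x|M. iexp (X x)) = (CLINT x|M. 1)" using 1 by (intro integral_cong_AE) auto
    ultimately show ?thesis by (simp add: prob_space)
  next
    case (2 \<mu> \<sigma>)
    have \<mu>: "\<mu> = 0" using normal_distributed_expectation[OF 2] mean by simp
    have v: "v = \<sigma>\<^sup>2" using normal_distributed_variance[OF 2] mean var by simp
    have D: "distributed M lborel (\<lambda>x. X x / \<sigma>) std_normal_density"
      using 2(2) normal_standard_normal_convert[OF 2(1), of X \<mu>] \<mu> by simp
    have "(CLINT x|M. iexp (X x)) = (CLINT x|M. iexp (\<sigma> * (X x / \<sigma>)))" using 2(1) by simp
    also have "\<dots> = (CLINT y|distr M lborel (\<lambda>x. X x / \<sigma>). iexp (\<sigma> * y))"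
      by (subst integral_distr) auto
    also have "\<dots> = char \<gamma> \<sigma>"
      using D by (simp add: distributed_distr_eq_density char_def)
    finally show ?thesis by (simp add: char_std_normal_distribution v)
  qed
qed

text \<open>Gram-Schmidt: the second component is the normalized residual of
  \<open>Y x / \<tau>\<close> after projection onto \<open>X x / \<sigma>\<close>. Every linear
  combination of the two components is Gaussian with variance s^2 + t^2, so the joint characteristic
  function factorizes.\<close>

lemma gaussian_pair_decorrelated:
  assumes M: "prob_space M" and G: "\<And>a b. gaussian_variable M (\<lambda>x. a * X x + b * Y x)"
    and mean: "(\<integral>x. X x \<partial>M) = 0" "(\<integral>x. Y x \<partial>M) = 0"
    and var: "(\<integral>x. (X x)\<^sup>2 \<partial>M) = \<sigma>\<^sup>2" "(\<integral>x. (Y x)\<^sup>2 \<partial>M) = \<tau>\<^sup>2"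
    and cov: "(\<integral>x. X x * Y x \<partial>M) = \<sigma> * \<tau> * \<rho>"
    and pos: "\<sigma> > 0" "\<tau> > 0" "\<bar>\<rho>\<bar> < 1"
  shows "distr M (\<gamma> \<Otimes>\<^sub>M \<gamma>)
      (\<lambda>x. (X x / \<sigma>, (Y x / \<tau> - \<rho> * (X x / \<sigma>)) / sqrt (1 - \<rho>\<^sup>2)))
    = \<gamma> \<Otimes>\<^sub>M \<gamma>"
proof -
  interpret prob_space M by fact
  have GX: "gaussian_variable M X" and GY: "gaussian_variable M Y" using G[of 1 0] G[of 0 1] by simp_all
  have [measurable]: "X \<in> borel_measurable M" "Y \<in> borel_measurable M"
    using GX GY by (simp_all add: gaussian_variable_def)
  note sq = gaussian_variable_square_integrable[OF M GX] gaussian_variable_square_integrable[OF M GY]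
  have i1: "integrable M X" "integrable M Y"
    using sq by (auto intro: square_integrable_imp_integrable)
  have xy: "integrable M (\<lambda>x. X x * Y x)"
  proof (rule Bochner_Integration.integrable_bound[of M "\<lambda>x. (X x)\<^sup>2 + (Y x)\<^sup>2"])
    show "AE x in M. norm (X x * Y x) \<le> norm ((X x)\<^sup>2 + (Y x)\<^sup>2)"
      using abs_mult_le_sum_squares by auto
  qed (use sq in auto)
  define r where "r = sqrt (1 - \<rho>\<^sup>2)"
  have "\<rho>\<^sup>2 < 1" using pos(3) by (simp add: abs_square_less_1)
  then have r: "r > 0" "r\<^sup>2 = 1 - \<rho>\<^sup>2" by (auto simp: r_def)
  show ?thesis unfolding r_def[symmetric]
  proof (rule joint_distribution_of_char_factorization[OF M _ _ prob_space_std_normal _ prob_space_std_normal])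
    fix s t
    \<comment> \<open>The combination with coefficients s and t of the decorrelated pair,
      re-expressed in \<open>X\<close> and \<open>Y\<close>.\<close>
    define a where "a = s / \<sigma> - t * \<rho> / (r * \<sigma>)"
    define b where "b = t / (\<tau> * r)"
    have comb: "s * (X x / \<sigma>) + t * ((Y x / \<tau> - \<rho> * (X x / \<sigma>)) / r) = a * X x + b * Y x" for x
      using pos r(1) unfolding a_def b_def by (simp add: field_simps)
    have "(\<integral>x. (a * X x + b * Y x)\<^sup>2 \<partial>M) = (\<integral>x. a\<^sup>2 * (X x)\<^sup>2 + b\<^sup>2 * (Y x)\<^sup>2 + 2 * a * b * (X x * Y x) \<partial>M)"
      by (simp add: power2_eq_square algebra_simps)
    also have "\<dots> = a\<^sup>2 * \<sigma>\<^sup>2 + b\<^sup>2 * \<tau>\<^sup>2 + 2 * a * b * (\<sigma> * \<tau> * \<rho>)"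
      using sq xy var cov by simp
    \<comment> \<open>Completing the square separates the contribution along \<open>X\<close> from
      the independent residual.\<close>
    also have "\<dots> = (a * \<sigma> + \<rho> * (b * \<tau>))\<^sup>2 + r\<^sup>2 * (b * \<tau>)\<^sup>2"
      unfolding r by (simp add: power2_eq_square algebra_simps)
    also have "a * \<sigma> + \<rho> * (b * \<tau>) = s" using pos r(1) by (simp add: a_def b_def field_simps)
    also have "b * \<tau> = t / r" using pos r(1) by (simp add: b_def)
    finally have v: "(\<integral>x. (a * X x + b * Y x)\<^sup>2 \<partial>M) = s\<^sup>2 + t\<^sup>2" using r(1) by (simp add: power_divide)
    have "(CLINT x|M. iexp (a * X x + b * Y x)) = exp (- (s\<^sup>2 + t\<^sup>2) / 2)"
      using i1 mean v by (intro gaussian_variable_char[OF M G]) auto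
    also have "\<dots> = char \<gamma> s * char \<gamma> t"
      unfolding char_std_normal_distribution of_real_mult[symmetric] exp_add[symmetric]
      by (simp add: field_simps)
    finally show "(CLINT x|M. iexp (s * (X x / \<sigma>) + t * ((Y x / \<tau> - \<rho> * (X x / \<sigma>)) / r)))
      = char \<gamma> s * char \<gamma> t" unfolding comb .
  qed simp_all
qed

lemma gaussian_variable_standardized:
  assumes M: "prob_space M" and G: "\<And>a. gaussian_variable M (\<lambda>x. a * X x)"
    and mean: "(\<integral>x. X x \<partial>M) = 0" and var: "(\<integral>x. (X x)\<^sup>2 \<partial>M) = \<sigma>\<^sup>2" and \<sigma>: "\<sigma> > 0"
  shows "distr M borel (\<lambda>x. X x / \<sigma>) = \<gamma>"
proof (rule Levy_uniqueness)
  interpret prob_space M by fact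
  have [measurable]: "X \<in> borel_measurable M" using G[of 1] by (simp add: gaussian_variable_def)
  show "real_distribution (distr M borel (\<lambda>x. X x / \<sigma>))" by (rule real_distribution_distr) simp
  show "real_distribution \<gamma>" by (rule real_dist_normal_dist)
  show "char (distr M borel (\<lambda>x. X x / \<sigma>)) = char \<gamma>"
  proof
    fix t
    have "char (distr M borel (\<lambda>x. X x / \<sigma>)) t = (CLINT x|M. iexp ((t / \<sigma>) * X x))"
      unfolding char_def by (subst integral_distr) auto
    also have "\<dots> = exp (- (t\<^sup>2) / 2)"
      using mean var \<sigma> by (intro gaussian_variable_char[OF M G]) (auto simp: power_mult_distrib power_divide)
    also have "\<dots> = char \<gamma> t" by (simp add: char_std_normal_distribution)
    finally show "char (distr M borel (\<lambda>x. X x / \<sigma>)) t = char \<gamma> t" .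
  qed
qed

subsection \<open>Expansions of Gaussian densities\<close>

text \<open>Multiplying the standard density by \<open>exp (x\<^sup>2 / 4)\<close> gives, up to the
  factor sqrt 2, the density of variance 2.\<close>

lemma std_normal_exp_quarter_square:
  "integrable \<gamma> (\<lambda>x. exp (x\<^sup>2 / 4))" "(\<integral>x. exp (x\<^sup>2 / 4) \<partial>\<gamma>) = sqrt 2"
proof -
  have *: "std_normal_density x * exp (x\<^sup>2 / 4) = sqrt 2 * normal_density 0 (sqrt 2) x" for x
  proof -
    have "exp (- x\<^sup>2 / 2) * exp (x\<^sup>2 / 4) = exp (- x\<^sup>2 / 4)"
      by (simp add: exp_add[symmetric])
    then show ?thesis by (simp add: normal_density_def real_sqrt_mult field_simps)
  qed
  show "integrable \<gamma> (\<lambda>x. exp (x\<^sup>2 / 4))"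
    by (subst integrable_density) (auto simp: *)
  show "(\<integral>x. exp (x\<^sup>2 / 4) \<partial>\<gamma>) = sqrt 2"
    by (subst integral_density) (auto simp: *)
qed

text \<open>The exponent 1/4 serves as a budget: 1/16 pays for the growth of f, and the remaining
  3/16 for polynomial weights and kernel remainders.\<close>

lemma
  fixes F :: "real \<Rightarrow> real"
  assumes [measurable]: "F \<in> borel_measurable borel" and F: "\<And>x. \<bar>F x\<bar> \<le> c * exp (x\<^sup>2 / 4)"
  shows std_normal_dominated_integrable: "integrable \<gamma> F"
    and std_normal_dominated_integral: "\<bar>\<integral>x. F x \<partial>\<gamma>\<bar> \<le> 2 * c"
proof -
  have c: "c \<ge> 0" using F[of 0] by simp
  have i: "integrable \<gamma> (\<lambda>x. c * exp (x\<^sup>2 / 4))"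
    using std_normal_exp_quarter_square by simp
  show "integrable \<gamma> F"
    by (rule Bochner_Integration.integrable_bound[OF i]) (use F c in \<open>auto simp: abs_mult\<close>)
  have "\<bar>\<integral>x. F x \<partial>\<gamma>\<bar> \<le> (\<integral>x. c * exp (x\<^sup>2 / 4) \<partial>\<gamma>)"
    using integral_mono[OF integrable_abs[OF \<open>integrable \<gamma> F\<close>] i F]
      integral_abs_bound[of \<gamma> F] by linarith
  also have "\<dots> = c * sqrt 2" using std_normal_exp_quarter_square by simp
  also have "\<dots> \<le> c * 2" using c real_sqrt_le_mono[of 2 4] by (intro mult_left_mono) auto
  finally show "\<bar>\<integral>x. F x \<partial>\<gamma>\<bar> \<le> 2 * c" by simp
qed

text \<open>The exponent is the logarithm of the density of mean \<open>b\<close> and standard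
  deviation \<open>c\<close> relative to the standard one. The parameters thus leave the argument of
  \<open>g\<close>, on which no smoothness is assumed.\<close>

lemma std_normal_integral_affine:
  fixes g :: "real \<Rightarrow> real"
  assumes [measurable]: "g \<in> borel_measurable borel" and c: "c > 0"
  shows "(\<integral>z. g (b + c * z) \<partial>\<gamma>)
    = (\<integral>y. g y * exp (- ln c + y\<^sup>2 / 2 - ((y - b) / c)\<^sup>2 / 2) \<partial>\<gamma>)"
proof -
  have "(\<integral>y. g y * exp (- ln c + y\<^sup>2 / 2 - ((y - b) / c)\<^sup>2 / 2) \<partial>\<gamma>)
      = (\<integral>y. g y * std_normal_density ((y - b) / c) / c \<partial>lborel)"
  proof (subst integral_density)
    have "std_normal_density y *\<^sub>R (g y * exp (- ln c + y\<^sup>2 / 2 - ((y - b) / c)\<^sup>2 / 2))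
        = g y * std_normal_density ((y - b) / c) / c" for y
    proof -
      have "exp (- ln c + y\<^sup>2 / 2 - ((y - b) / c)\<^sup>2 / 2)
          = exp (- ((y - b) / c)\<^sup>2 / 2) / (exp (- y\<^sup>2 / 2) * exp (ln c))"
        by (simp add: exp_add[symmetric] exp_diff[symmetric] algebra_simps)
      then show ?thesis using c by (simp add: std_normal_density_def)
    qed
    then show "(\<integral>y. std_normal_density y *\<^sub>R (g y * exp (- ln c + y\<^sup>2 / 2 - ((y - b) / c)\<^sup>2 / 2)) \<partial>lborel)
        = (\<integral>y. g y * std_normal_density ((y - b) / c) / c \<partial>lborel)" by simp
  qed auto
  also have "\<dots> = (\<integral>z. g (b + c * z) * std_normal_density z \<partial>lborel)"
    using c by (subst lborel_integral_real_affine[where c = c and t = b]) auto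
  also have "\<dots> = (\<integral>z. g (b + c * z) \<partial>\<gamma>)"
    by (subst integral_density) (auto simp: mult_ac)
  finally show ?thesis by simp
qed

lemma abs_exp_Taylor1: "\<bar>exp q - 1 - q\<bar> \<le> exp \<bar>q\<bar> * \<bar>q\<bar> ^ 2" for q :: real
  using Taylor_exp_field[of q 1] by (simp add: numeral_2_eq_2 algebra_simps)

lemma abs_exp_Taylor2: "\<bar>exp q - 1 - q - q\<^sup>2 / 2\<bar> \<le> exp \<bar>q\<bar> * \<bar>q\<bar> ^ 3" for q :: real
proof -
  have "\<bar>exp q - (\<Sum>i\<le>2. q ^ i / fact i)\<bar> \<le> exp \<bar>q\<bar> * \<bar>q\<bar> ^ 3 / 2"
    using Taylor_exp_field[of q 2] by (simp add: eval_nat_numeral)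
  also have "\<dots> \<le> exp \<bar>q\<bar> * \<bar>q\<bar> ^ 3" by simp
  also have "(\<Sum>i\<le>2. q ^ i / fact i) = 1 + q + q\<^sup>2 / 2" by (simp add: eval_nat_numeral)
  finally show ?thesis by (simp add: algebra_simps)
qed

lemma one_plus_le_scaled_exp: "1 + s \<le> c * exp (s / c)" if "c \<ge> 1" for s c :: real
proof -
  have "c * (1 + s / c) \<le> c * exp (s / c)"
    using that exp_ge_add_one_self[of "s / c"] by (intro mult_left_mono) auto
  then show ?thesis using that by (simp add: distrib_left)
qed

text \<open>The exponent s / 16 is shared equally by the k factors, each costing the constant 16 k;
  hence the numbers 48^3 and 32^2 below.\<close>

lemma one_plus_power_le_exp:
  assumes "s \<ge> 0" "k > 0" shows "(1 + s) ^ k \<le> (16 * k) ^ k * exp (s / 16 :: real)"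
proof -
  have "(1 + s) ^ k \<le> (16 * k * exp (s / (16 * k))) ^ k"
    using assms by (intro power_mono one_plus_le_scaled_exp) auto
  also have "\<dots> = (16 * k) ^ k * exp (s / 16)"
    using assms by (simp add: power_mult_distrib exp_of_nat_mult[symmetric])
  finally show ?thesis by simp
qed

text \<open>\<open>exp Q\<close> is the density of a standard Gaussian pair with correlation \<open>\<rho>\<close> relative to the
  independent pair, and in the next lemma that of variance \<open>1 + a\<close> relative to variance \<open>1\<close>.\<close>

lemma Mehler_kernel_expansion:
  fixes \<rho> x y :: real
  assumes \<rho>: "\<bar>\<rho>\<bar> \<le> 1 / 5"
  defines "Q \<equiv> - ln (1 - \<rho>\<^sup>2) / 2 + (\<rho> * x * y - \<rho>\<^sup>2 * (x\<^sup>2 + y\<^sup>2) / 2) / (1 - \<rho>\<^sup>2)"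
  shows "\<bar>exp Q - (1 + \<rho> * (x * y) + \<rho>\<^sup>2 / 2 * ((x\<^sup>2 - 1) * (y\<^sup>2 - 1)))\<bar>
    \<le> (5 * 48 ^ 3) * \<bar>\<rho>\<bar> ^ 3 * exp (3 / 16 * (x\<^sup>2 + y\<^sup>2))"
proof -
  define r where "r = \<bar>\<rho>\<bar>"
  define s where "s = x\<^sup>2 + y\<^sup>2"
  define W where "W = 1 + s"
  define q where "q = \<rho> * x * y - \<rho>\<^sup>2 * s / 2"
  define l where "l = - ln (1 - \<rho>\<^sup>2) / 2"
  have r: "0 \<le> r" "r \<le> 1 / 5" "\<rho>\<^sup>2 = r\<^sup>2" using \<rho> by (auto simp: r_def)
  have s: "s \<ge> 0" and W: "W \<ge> 1" by (auto simp: s_def W_def)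
  have r2: "r\<^sup>2 \<le> r * (1 / 5)" unfolding power2_eq_square using r by (intro mult_left_mono) auto
  have r3: "r ^ 3 = r * r\<^sup>2" by (simp add: eval_nat_numeral)
  have r32: "r ^ 3 \<le> r\<^sup>2 * (1 / 5)" unfolding r3 using mult_right_mono[OF r(2), of "r\<^sup>2"] by simp
  have xy: "\<bar>x * y\<bar> \<le> s / 2"
    using sum_squares_bound[of "\<bar>x\<bar>" "\<bar>y\<bar>"] by (simp add: s_def abs_mult)
  have rxy: "\<bar>\<rho> * x * y\<bar> \<le> r * (s / 2)"
    using xy r by (simp add: abs_mult r_def mult.assoc mult_left_mono)
  have qb: "\<bar>q\<bar> \<le> r * (1 + r) * (s / 2)"
  proof -
    have "\<bar>q\<bar> \<le> \<bar>\<rho> * x * y\<bar> + \<bar>\<rho>\<^sup>2 * s / 2\<bar>" unfolding q_def by (rule abs_triangle_ineq4)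
    also have "\<bar>\<rho>\<^sup>2 * s / 2\<bar> = r\<^sup>2 * (s / 2)" using s r by simp
    finally show ?thesis using rxy by (simp add: algebra_simps power2_eq_square)
  qed
  have pos: "1 - \<rho>\<^sup>2 \<ge> 24 / 25" using r r2 by simp
  have Q: "Q = l + q / (1 - \<rho>\<^sup>2)" by (simp add: Q_def l_def q_def s_def)
  have l: "\<bar>l - \<rho>\<^sup>2 / 2\<bar> \<le> r ^ 3"
  proof -
    have "\<bar>ln (1 + - \<rho>\<^sup>2) - - \<rho>\<^sup>2\<bar> \<le> 2 * (- \<rho>\<^sup>2)\<^sup>2"
      using pos by (intro abs_ln_one_plus_x_minus_x_bound) auto
    then have "\<bar>l - \<rho>\<^sup>2 / 2\<bar> \<le> (r\<^sup>2)\<^sup>2" using r(3) by (simp add: l_def abs_if split: if_splits)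
    also have "\<dots> = r ^ 3 * r" by (simp add: eval_nat_numeral)
    also have "\<dots> \<le> r ^ 3 * 1" using r by (intro mult_left_mono) auto
    finally show ?thesis by simp
  qed
  have q1: "\<bar>q / (1 - \<rho>\<^sup>2) - q\<bar> \<le> r ^ 3 * s"
  proof -
    have "q / (1 - \<rho>\<^sup>2) - q = q * (r\<^sup>2 / (1 - \<rho>\<^sup>2))" using pos r(3) by (simp add: field_simps)
    then have "\<bar>q / (1 - \<rho>\<^sup>2) - q\<bar> = \<bar>q\<bar> * (r\<^sup>2 / (1 - \<rho>\<^sup>2))" using pos by (simp add: abs_mult)
    also have "\<dots> \<le> (r * (1 + r) * (s / 2)) * (r\<^sup>2 / (24 / 25))"
      using pos qb r s by (intro mult_mono divide_left_mono) auto
    also have "\<dots> = r ^ 3 * s * ((1 + r) * (25 / 48))" unfolding r3 by simp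
    also have "\<dots> \<le> r ^ 3 * s * 1" using r s by (intro mult_left_mono) auto
    finally show ?thesis by simp
  qed
  \<comment> \<open>To second order in \<rho>, the exponent \<open>Q\<close> is \<rho> x y +
    \<rho>^2 (1 - s) / 2; \<open>E\<close> is what remains, of third order.\<close>
  define E where "E = Q - \<rho> * x * y - \<rho>\<^sup>2 * (1 - s) / 2"
  have E: "\<bar>E\<bar> \<le> r ^ 3 * W"
  proof -
    have "E = (l - \<rho>\<^sup>2 / 2) + (q / (1 - \<rho>\<^sup>2) - q)" unfolding E_def Q by (simp add: q_def algebra_simps diff_divide_distrib)
    then have "\<bar>E\<bar> \<le> r ^ 3 + r ^ 3 * s" using l q1 by linarith
    then show ?thesis by (simp add: W_def algebra_simps)
  qed
  have EW: "\<bar>E\<bar> \<le> r\<^sup>2 * W * (1 / 5)"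
  proof -
    have "r ^ 3 * W \<le> r\<^sup>2 * (1 / 5) * W" using r32 W by (intro mult_right_mono) auto
    also have "\<dots> = r\<^sup>2 * W * (1 / 5)" by simp
    finally show ?thesis using E by linarith
  qed
  have h: "\<bar>\<rho>\<^sup>2 * (1 - s) / 2\<bar> \<le> r\<^sup>2 * W * (1 / 2)"
  proof -
    have "\<bar>1 - s\<bar> \<le> W" using s by (simp add: W_def)
    then have "r\<^sup>2 * \<bar>1 - s\<bar> \<le> r\<^sup>2 * W" by (intro mult_left_mono) auto
    then show ?thesis using r(3) by (simp add: abs_mult)
  qed
  have Q1: "\<bar>Q - \<rho> * x * y\<bar> \<le> r\<^sup>2 * W"
  proof -
    have "Q - \<rho> * x * y = \<rho>\<^sup>2 * (1 - s) / 2 + E" by (simp add: E_def)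
    moreover have "0 \<le> r\<^sup>2 * W" using W by simp
    ultimately show ?thesis using EW h by linarith
  qed
  have rxyW: "\<bar>\<rho> * x * y\<bar> \<le> r * W * (1 / 2)"
    using rxy r by (simp add: W_def algebra_simps)
  have Q2: "\<bar>Q\<bar> \<le> r * W"
  proof -
    have "r\<^sup>2 * W \<le> r * W * (1 / 5)" using mult_right_mono[OF r2, of W] W by (simp add: mult_ac)
    moreover have "0 \<le> r * W" using r W by simp
    ultimately show ?thesis using Q1 rxyW by linarith
  qed
  \<comment> \<open>\<open>Q2\<close> supplies the smallness in \<rho>, this bound the growth in s.
    It fixes the range of \<rho>: for |\<rho>| at most 1/5 the coefficient of s is at most (3/25) /
    (24/25) = 1/8, which with 1/16 for the polynomial factor makes 3/16.\<close>
  have Q3: "\<bar>Q\<bar> \<le> 1 + s / 8"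
  proof -
    have "r * (1 + r) * (s / 2) \<le> 1 / 5 * (6 / 5) * (s / 2)"
      using r s by (intro mult_mono) auto
    from order_trans[OF qb this] have "\<bar>q\<bar> \<le> 3 / 25 * s" by simp
    then have "\<bar>q\<bar> / (1 - \<rho>\<^sup>2) \<le> (3 / 25 * s) / (24 / 25)"
      using pos s by (intro frac_le) auto
    then have "\<bar>q / (1 - \<rho>\<^sup>2)\<bar> \<le> s / 8" unfolding abs_divide using pos by simp
    moreover have "\<bar>l\<bar> \<le> 1"
    proof -
      have "0 \<le> \<rho>\<^sup>2" "\<rho>\<^sup>2 \<le> 1 / 25" using pos by simp_all
      moreover have "r ^ 3 \<le> 1 / 5"
      proof -
        have "r\<^sup>2 \<le> 1 / 25" using r r2 by linarith
        then show ?thesis using r32 by linarith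
      qed
      ultimately show ?thesis using l unfolding abs_le_iff by linarith
    qed
    ultimately show ?thesis unfolding Q by linarith
  qed
  have T: "\<bar>exp Q - 1 - Q - Q\<^sup>2 / 2\<bar> \<le> 3 * r ^ 3 * W ^ 3 * exp (s / 8)"
  proof -
    have "\<bar>exp Q - 1 - Q - Q\<^sup>2 / 2\<bar> \<le> exp \<bar>Q\<bar> * \<bar>Q\<bar> ^ 3" by (rule abs_exp_Taylor2)
    also have "\<dots> \<le> exp (1 + s / 8) * (r * W) ^ 3"
      using Q2 Q3 by (intro mult_mono power_mono) auto
    also have "exp (1 + s / 8) \<le> 3 * exp (s / 8)" unfolding exp_add using exp_le by (intro mult_right_mono) auto
    finally show ?thesis using r W by (simp add: power_mult_distrib mult_ac mult_right_mono)
  qed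
  \<comment> \<open>Since (x^2 - 1) (y^2 - 1) = (x y)^2 + 1 - s, the difference is \<open>E\<close>
    plus half of Q^2 - (\<rho> x y)^2, and the latter factors with one factor of second order and
    one of first order.\<close>
  have P: "\<bar>Q + Q\<^sup>2 / 2 - (\<rho> * (x * y) + \<rho>\<^sup>2 / 2 * ((x\<^sup>2 - 1) * (y\<^sup>2 - 1)))\<bar> \<le> 2 * (r ^ 3 * W ^ 3)"
  proof -
    have "Q + Q\<^sup>2 / 2 - (\<rho> * (x * y) + \<rho>\<^sup>2 / 2 * ((x\<^sup>2 - 1) * (y\<^sup>2 - 1)))
        = E + (Q - \<rho> * x * y) * (Q + \<rho> * x * y) / 2"
      by (simp add: E_def s_def power2_eq_square field_simps)
    moreover have "\<bar>(Q - \<rho> * x * y) * (Q + \<rho> * x * y) / 2\<bar> \<le> r ^ 3 * W ^ 3"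
    proof -
      have "\<bar>Q + \<rho> * x * y\<bar> \<le> 2 * (r * W)"
      proof -
        have "0 \<le> r * W" using r W by simp
        then show ?thesis using Q2 rxyW by linarith
      qed
      then have "\<bar>Q - \<rho> * x * y\<bar> * \<bar>Q + \<rho> * x * y\<bar> \<le> (r\<^sup>2 * W) * (2 * (r * W))"
        using Q1 r W by (intro mult_mono) auto
      then have "\<bar>(Q - \<rho> * x * y) * (Q + \<rho> * x * y) / 2\<bar> \<le> r ^ 3 * W\<^sup>2"
        unfolding r3 by (simp add: abs_mult power2_eq_square mult_ac)
      also have "\<dots> \<le> r ^ 3 * W ^ 3" using r W by (intro mult_left_mono power_increasing) auto
      finally show ?thesis .
    qed
    moreover have "r ^ 3 * W \<le> r ^ 3 * W ^ 3" using r W self_le_power[of W 3] by (intro mult_left_mono) auto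
    ultimately show ?thesis using E by linarith
  qed
  have "\<bar>exp Q - (1 + \<rho> * (x * y) + \<rho>\<^sup>2 / 2 * ((x\<^sup>2 - 1) * (y\<^sup>2 - 1)))\<bar>
      \<le> 3 * r ^ 3 * W ^ 3 * exp (s / 8) + 2 * (r ^ 3 * W ^ 3)"
    using T P by linarith
  also have "\<dots> \<le> 3 * r ^ 3 * W ^ 3 * exp (s / 8) + 2 * (r ^ 3 * W ^ 3) * exp (s / 8)"
  proof -
    have "2 * (r ^ 3 * W ^ 3) * 1 \<le> 2 * (r ^ 3 * W ^ 3) * exp (s / 8)"
      using r W s by (intro mult_left_mono) auto
    then show ?thesis by (simp only: mult_1_right add_left_mono)
  qed
  also have "\<dots> = 5 * r ^ 3 * (W ^ 3 * exp (s / 8))" by (simp add: algebra_simps)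
  also have "\<dots> \<le> 5 * r ^ 3 * (48 ^ 3 * exp (s / 16) * exp (s / 8))"
    using one_plus_power_le_exp[of s 3] s r by (intro mult_left_mono mult_right_mono) (auto simp: W_def)
  also have "\<dots> = (5 * 48 ^ 3) * r ^ 3 * exp (3 / 16 * s)"
    by (simp add: exp_add[symmetric] mult.assoc)
  finally show ?thesis by (simp add: r_def s_def)
qed

lemma variance_change_expansion:
  fixes a x :: real
  assumes a: "\<bar>a\<bar> \<le> 1 / 5"
  defines "Q \<equiv> - ln (1 + a) / 2 + a * x\<^sup>2 / (2 * (1 + a))"
  shows "\<bar>exp Q - (1 + a / 2 * (x\<^sup>2 - 1))\<bar> \<le> (4 * 32\<^sup>2) * a\<^sup>2 * exp (3 / 16 * x\<^sup>2)"
proof -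
  define r where "r = \<bar>a\<bar>"
  define s where "s = x\<^sup>2"
  define W where "W = 1 + s"
  have r: "0 \<le> r" "r \<le> 1 / 5" "a\<^sup>2 = r\<^sup>2" using a by (auto simp: r_def)
  have s: "s \<ge> 0" and W: "W \<ge> 1" by (auto simp: s_def W_def)
  have r2: "r\<^sup>2 \<le> r * (1 / 5)" unfolding power2_eq_square using r by (intro mult_left_mono) auto
  have pos: "1 + a \<ge> 4 / 5" using a by linarith
  have l: "\<bar>- ln (1 + a) / 2 - - a / 2\<bar> \<le> r\<^sup>2"
  proof -
    have "\<bar>ln (1 + a) - a\<bar> \<le> 2 * a\<^sup>2" using a by (intro abs_ln_one_plus_x_minus_x_bound) auto
    then show ?thesis unfolding r(3)[symmetric] by linarith
  qed
  have q: "\<bar>a * s / (2 * (1 + a)) - a * s / 2\<bar> \<le> r\<^sup>2 * s"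
  proof -
    have "a * s / (2 * (1 + a)) - a * s / 2 = - (r\<^sup>2 * s) / (2 * (1 + a))"
      unfolding r(3)[symmetric] using pos by (simp add: field_simps power2_eq_square)
    then have "\<bar>a * s / (2 * (1 + a)) - a * s / 2\<bar> = (r\<^sup>2 * s) / (2 * (1 + a))"
      using pos s by simp
    also have "\<dots> \<le> (r\<^sup>2 * s) / 1" using pos s by (intro divide_left_mono) auto
    finally show ?thesis by simp
  qed
  have E: "\<bar>Q - a / 2 * (s - 1)\<bar> \<le> r\<^sup>2 * W"
  proof -
    have "Q - a / 2 * (s - 1) = (- ln (1 + a) / 2 - - a / 2) + (a * s / (2 * (1 + a)) - a * s / 2)"
      by (simp add: Q_def s_def algebra_simps)
    then show ?thesis using l q by (simp add: W_def algebra_simps)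
  qed
  have Q2: "\<bar>Q\<bar> \<le> r * W"
  proof -
    have "\<bar>s - 1\<bar> \<le> W" using s by (simp add: W_def)
    then have "\<bar>a / 2 * (s - 1)\<bar> \<le> r * W / 2" by (simp add: abs_mult r_def mult_left_mono)
    moreover have "r\<^sup>2 * W \<le> r * W * (1 / 5)" using mult_right_mono[OF r2, of W] W by (simp add: mult_ac)
    moreover have "0 \<le> r * W" using r W by simp
    ultimately show ?thesis using E by linarith
  qed
  \<comment> \<open>The range of \<open>a\<close> is fixed as before: (1/5) / (2 * (4/5)) =
    1/8.\<close>
  have Q3: "\<bar>Q\<bar> \<le> 1 + s / 8"
  proof -
    have "\<bar>a * s / (2 * (1 + a))\<bar> = r * s / (2 * (1 + a))" using pos s by (simp add: abs_mult r_def)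
    also have "\<dots> \<le> (1 / 5) * s / (2 * (4 / 5))" using pos r s by (intro frac_le mult_right_mono) auto
    finally have "\<bar>a * s / (2 * (1 + a))\<bar> \<le> s / 8" by simp
    moreover have "\<bar>- ln (1 + a) / 2\<bar> \<le> 1" using l r r2 a by linarith
    ultimately show ?thesis unfolding Q_def s_def[symmetric] by linarith
  qed
  have T: "\<bar>exp Q - 1 - Q\<bar> \<le> 3 * r\<^sup>2 * W\<^sup>2 * exp (s / 8)"
  proof -
    have "\<bar>exp Q - 1 - Q\<bar> \<le> exp \<bar>Q\<bar> * \<bar>Q\<bar>\<^sup>2" by (rule abs_exp_Taylor1)
    also have "\<dots> \<le> exp (1 + s / 8) * (r * W)\<^sup>2"
      using Q2 Q3 by (intro mult_mono power_mono) auto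
    also have "exp (1 + s / 8) \<le> 3 * exp (s / 8)" unfolding exp_add using exp_le by (intro mult_right_mono) auto
    finally show ?thesis using r W by (simp add: power_mult_distrib mult_ac mult_right_mono)
  qed
  have "r\<^sup>2 * W \<le> r\<^sup>2 * (W\<^sup>2 * exp (s / 8))"
  proof (intro mult_left_mono)
    have "W * 1 \<le> W\<^sup>2 * exp (s / 8)"
      using W s self_le_power[of W 2] by (intro mult_mono) auto
    then show "W \<le> W\<^sup>2 * exp (s / 8)" by simp
  qed auto
  then have "\<bar>exp Q - (1 + a / 2 * (s - 1))\<bar> \<le> 4 * r\<^sup>2 * (W\<^sup>2 * exp (s / 8))"
    using T E by linarith
  also have "\<dots> \<le> 4 * r\<^sup>2 * (32\<^sup>2 * exp (s / 16) * exp (s / 8))"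
    using one_plus_power_le_exp[of s 2] s r by (intro mult_left_mono mult_right_mono) (auto simp: W_def)
  also have "\<dots> = (4 * 32\<^sup>2) * r\<^sup>2 * exp (3 / 16 * s)"
    by (simp add: exp_add[symmetric] mult.assoc)
  finally show ?thesis unfolding r(3) s_def .
qed

subsection \<open>Gaussian moments of a Lipschitz function\<close>

definition moment :: "(real \<Rightarrow> real) \<Rightarrow> (real \<Rightarrow> real) \<Rightarrow> real \<Rightarrow> real" where
  "moment f p \<sigma> = (\<integral>x. f (\<sigma> * x) * p x \<partial>\<gamma>)"

text \<open>The argument is the deviation of the variance from 1. As the correlation is the
  covariance divided by both standard deviations, dividing the first moment by the standard
  deviation and the second by the variance turns powers of the correlation into powers of the
  covariance. At argument 0 the three functions are \<open>zeta 0 f\<close>, \<open>zeta 1 f\<close>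
  and \<open>zeta 2 f\<close>.\<close>

definition coeff0 :: "(real \<Rightarrow> real) \<Rightarrow> real \<Rightarrow> real" where
  "coeff0 f a = moment f (\<lambda>x. 1) (sqrt (1 + a))"
definition coeff1 :: "(real \<Rightarrow> real) \<Rightarrow> real \<Rightarrow> real" where
  "coeff1 f a = moment f (\<lambda>x. x) (sqrt (1 + a)) / sqrt (1 + a)"
definition coeff2 :: "(real \<Rightarrow> real) \<Rightarrow> real \<Rightarrow> real" where
  "coeff2 f a = moment f (\<lambda>x. x\<^sup>2 - 1) (sqrt (1 + a)) / (1 + a) / sqrt 2"

lemma hermite_012:
  "hermite 0 t = 1" "hermite 1 t = t" "hermite 2 t = t\<^sup>2 - 1"
proof -
  have d1: "deriv (\<lambda>s::real. exp (- s\<^sup>2 / 2)) = (\<lambda>s. - s * exp (- s\<^sup>2 / 2))"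
    by (intro ext DERIV_imp_deriv) (auto intro!: derivative_eq_intros)
  have d2: "deriv (\<lambda>s::real. - s * exp (- s\<^sup>2 / 2)) = (\<lambda>s. (s\<^sup>2 - 1) * exp (- s\<^sup>2 / 2))"
    by (intro ext DERIV_imp_deriv) (auto intro!: derivative_eq_intros simp: algebra_simps power2_eq_square)
  have e: "exp (t\<^sup>2 / 2) * exp (- t\<^sup>2 / 2) = 1" by (simp add: exp_add[symmetric])
  have e': "exp (t\<^sup>2 / 2) * (z * exp (- t\<^sup>2 / 2)) = z" for z
    using e by (metis mult.left_commute mult.right_neutral)
  show "hermite 0 t = 1" unfolding hermite_def using e by simp
  show "hermite 1 t = t" unfolding hermite_def using d1 e'[of t] by simp
  have "(deriv ^^ 2) (\<lambda>s::real. exp (- s\<^sup>2 / 2)) = (\<lambda>s. (s\<^sup>2 - 1) * exp (- s\<^sup>2 / 2))"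
  proof -
    have "(deriv ^^ 2) g = deriv (deriv g)" for g :: "real \<Rightarrow> real" by (simp add: numeral_2_eq_2)
    then show ?thesis by (simp only: d1 d2)
  qed
  then show "hermite 2 t = t\<^sup>2 - 1" unfolding hermite_def using e'[of "t\<^sup>2 - 1"] by simp
qed

lemma zeta_moment:
  "zeta 0 f = moment f (\<lambda>x. 1) 1" "zeta 1 f = moment f (\<lambda>x. x) 1"
  "zeta 2 f = moment f (\<lambda>x. x\<^sup>2 - 1) 1 / sqrt 2"
  by (simp_all add: zeta_def moment_def hermite_012 del: One_nat_def)

lemma abs_sqrt_diff_one_le: "\<bar>sqrt (1 + a) - 1\<bar> \<le> \<bar>a\<bar>" if "a \<ge> - 1"
proof -
  define s where "s = sqrt (1 + a)"
  have s: "s \<ge> 0" "s * s = 1 + a" using that by (simp_all add: s_def)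
  have "a = (s - 1) * (s + 1)" using s(2) by (simp add: algebra_simps)
  then have "\<bar>a\<bar> = \<bar>s - 1\<bar> * (s + 1)" using s(1) by (simp add: abs_mult)
  moreover have "\<bar>s - 1\<bar> * 1 \<le> \<bar>s - 1\<bar> * (s + 1)" using s(1) by (intro mult_left_mono) auto
  ultimately show ?thesis by (simp add: s_def)
qed

lemma sqrt_one_plus_bounds:
  assumes "\<bar>a\<bar> \<le> 1 / 5"
  shows "1 / 2 \<le> sqrt (1 + a)" "sqrt (1 + a) \<le> 2"
proof -
  have "sqrt ((1/2)\<^sup>2) \<le> sqrt (1 + a)" using assms by (intro real_sqrt_le_mono) (auto simp: power2_eq_square)
  then show "1 / 2 \<le> sqrt (1 + a)" by simp
  have "sqrt (1 + a) \<le> sqrt (2\<^sup>2)" using assms by (intro real_sqrt_le_mono) auto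
  then show "sqrt (1 + a) \<le> 2" by simp
qed

text \<open>One constant for both the slope and the value at 0, so that growth and all later
  constants depend on \<open>K\<close> alone.\<close>

locale lipschitz_fun =
  fixes f :: "real \<Rightarrow> real" and K :: real
  assumes lip: "\<bar>f x - f y\<bar> \<le> K * \<bar>x - y\<bar>" and f0: "\<bar>f 0\<bar> \<le> K"
begin

lemma K_nonneg: "K \<ge> 0" using f0 by linarith

lemma f_measurable[measurable]: "f \<in> borel_measurable borel"
proof -
  have "K-lipschitz_on UNIV f"
    using lip K_nonneg by (intro lipschitz_onI) (auto simp: dist_real_def)
  then show ?thesis
    by (intro borel_measurable_continuous_onI lipschitz_on_continuous_on)
qed

lemma f_growth:
  assumes "0 \<le> \<sigma>" "\<sigma> \<le> 2" shows "\<bar>f (\<sigma> * x)\<bar> \<le> 32 * K * exp (x\<^sup>2 / 16)"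
proof -
  have "\<bar>f (\<sigma> * x)\<bar> \<le> K * \<bar>\<sigma> * x\<bar> + K" using lip[of "\<sigma> * x" 0] f0 by simp
  also have "\<dots> \<le> K * (2 * \<bar>x\<bar>) + K"
    using assms K_nonneg by (intro add_mono mult_left_mono) (auto simp: abs_mult mult_right_mono)
  also have "\<dots> = K * (1 + 2 * \<bar>x\<bar>)" by (simp add: algebra_simps)
  also have "\<dots> \<le> K * (2 * (1 + x\<^sup>2))"
  proof -
    have "0 \<le> (\<bar>x\<bar> - 1)\<^sup>2" by simp
    then have "2 * \<bar>x\<bar> \<le> 1 + x\<^sup>2" by (simp add: power2_diff)
    then have "1 + 2 * \<bar>x\<bar> \<le> (1 + x\<^sup>2) + (1 + x\<^sup>2)" by (intro add_mono) auto
    then have "1 + 2 * \<bar>x\<bar> \<le> 2 * (1 + x\<^sup>2)" by simp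
    then show ?thesis using K_nonneg by (rule mult_left_mono)
  qed
  also have "\<dots> \<le> K * (2 * (16 * exp (x\<^sup>2 / 16)))"
    using K_nonneg one_plus_le_scaled_exp[of 16 "x\<^sup>2"] by (intro mult_left_mono) auto
  finally show ?thesis by simp
qed

lemma f_times_dominated:
  assumes "0 \<le> \<sigma>" "\<sigma> \<le> 2" "\<bar>p\<bar> \<le> c * exp (3 / 16 * x\<^sup>2)"
  shows "\<bar>f (\<sigma> * x) * p\<bar> \<le> (32 * K * c) * exp (x\<^sup>2 / 4)"
proof -
  have "\<bar>f (\<sigma> * x) * p\<bar> \<le> (32 * K * exp (x\<^sup>2 / 16)) * (c * exp (3 / 16 * x\<^sup>2))"
    unfolding abs_mult using assms K_nonneg by (intro mult_mono f_growth) auto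
  also have "\<dots> = (32 * K * c) * (exp (x\<^sup>2 / 16) * exp (3 / 16 * x\<^sup>2))" by simp
  also have "exp (x\<^sup>2 / 16) * exp (3 / 16 * x\<^sup>2) = exp (x\<^sup>2 / 4)"
    by (simp add: exp_add[symmetric])
  finally show ?thesis .
qed

lemma
  assumes \<sigma>: "0 \<le> \<sigma>" "\<sigma> \<le> 2" and [measurable]: "p \<in> borel_measurable borel"
    and p: "\<And>x. \<bar>p x\<bar> \<le> c * exp (3 / 16 * x\<^sup>2)"
  shows f_times_integrable: "integrable \<gamma> (\<lambda>x. f (\<sigma> * x) * p x)"
    and f_times_integral_le: "\<bar>\<integral>x. f (\<sigma> * x) * p x \<partial>\<gamma>\<bar> \<le> 64 * K * c"
proof -
  have *: "\<bar>f (\<sigma> * x) * p x\<bar> \<le> (32 * K * c) * exp (x\<^sup>2 / 4)" for x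
    using \<sigma> p by (rule f_times_dominated)
  show "integrable \<gamma> (\<lambda>x. f (\<sigma> * x) * p x)"
    by (rule std_normal_dominated_integrable[OF _ *]) simp
  show "\<bar>\<integral>x. f (\<sigma> * x) * p x \<partial>\<gamma>\<bar> \<le> 64 * K * c"
    using std_normal_dominated_integral[OF _ *] by simp
qed

text \<open>A common, generous constant for all weights; it makes the moment bounds below 64 * 256 =
  2^14 times \<open>K\<close>.\<close>

lemma weight_bound:
  fixes x :: real
  shows "\<bar>1\<bar> \<le> 256 * exp (3 / 16 * x\<^sup>2)" "\<bar>x\<bar> \<le> 256 * exp (3 / 16 * x\<^sup>2)"
    "\<bar>x\<^sup>2 - 1\<bar> \<le> 256 * exp (3 / 16 * x\<^sup>2)" "\<bar>x\<bar> * \<bar>x\<bar> \<le> 256 * exp (3 / 16 * x\<^sup>2)"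
proof -
  have "1 + x\<^sup>2 \<le> 16 * exp (x\<^sup>2 / 16)" by (rule one_plus_le_scaled_exp) simp
  also have "\<dots> \<le> 256 * exp (3 / 16 * x\<^sup>2)" by (intro mult_mono) auto
  finally have *: "1 + x\<^sup>2 \<le> 256 * exp (3 / 16 * x\<^sup>2)" .
  have "0 \<le> (\<bar>x\<bar> - 1)\<^sup>2" by simp
  then have x: "2 * \<bar>x\<bar> \<le> 1 + x\<^sup>2" by (simp add: power2_diff)
  show "\<bar>1\<bar> \<le> 256 * exp (3 / 16 * x\<^sup>2)" "\<bar>x\<bar> \<le> 256 * exp (3 / 16 * x\<^sup>2)"
    "\<bar>x\<^sup>2 - 1\<bar> \<le> 256 * exp (3 / 16 * x\<^sup>2)" "\<bar>x\<bar> * \<bar>x\<bar> \<le> 256 * exp (3 / 16 * x\<^sup>2)"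
    using * x zero_le_power2[of x] abs_mult_self_eq[of x] unfolding power2_eq_square[symmetric] power2_abs
    by linarith+
qed

lemma moment_integrable:
  assumes "0 \<le> \<sigma>" "\<sigma> \<le> 2"
  shows "integrable \<gamma> (\<lambda>x. f (\<sigma> * x) * 1)" "integrable \<gamma> (\<lambda>x. f (\<sigma> * x) * x)"
    "integrable \<gamma> (\<lambda>x. f (\<sigma> * x) * (x\<^sup>2 - 1))"
  by (rule f_times_integrable[OF assms _ weight_bound(1)] f_times_integrable[OF assms _ weight_bound(2)]
      f_times_integrable[OF assms _ weight_bound(3)]; simp)+

lemma moment_bound:
  assumes "0 \<le> \<sigma>" "\<sigma> \<le> 2"
  shows "\<bar>moment f (\<lambda>x. 1) \<sigma>\<bar> \<le> 2 ^ 14 * K" "\<bar>moment f (\<lambda>x. x) \<sigma>\<bar> \<le> 2 ^ 14 * K"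
    "\<bar>moment f (\<lambda>x. x\<^sup>2 - 1) \<sigma>\<bar> \<le> 2 ^ 14 * K"
  using f_times_integral_le[OF assms _ weight_bound(1)]
    f_times_integral_le[OF assms _ weight_bound(2)]
    f_times_integral_le[OF assms _ weight_bound(3)]
  by (simp_all add: moment_def)

section \<open>Expansions in the correlation and in the variance\<close>

lemma pair_expansion_inner:
  assumes \<tau>: "0 \<le> \<tau>" "\<tau> \<le> 2" and \<rho>: "\<bar>\<rho>\<bar> \<le> 1 / 5"
  shows "\<bar>(\<integral>z. f (\<tau> * (\<rho> * x + sqrt (1 - \<rho>\<^sup>2) * z)) \<partial>\<gamma>)
      - (moment f (\<lambda>x. 1) \<tau> + \<rho> * x * moment f (\<lambda>x. x) \<tau> + \<rho>\<^sup>2 / 2 * (x\<^sup>2 - 1) * moment f (\<lambda>x. x\<^sup>2 - 1) \<tau>)\<bar>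
    \<le> (320 * 48 ^ 3) * K * \<bar>\<rho>\<bar> ^ 3 * exp (3 / 16 * x\<^sup>2)"
proof -
  define c where "c = sqrt (1 - \<rho>\<^sup>2)"
  have "\<bar>\<rho>\<bar>\<^sup>2 \<le> (1 / 5)\<^sup>2" using \<rho> by (intro power_mono) auto
  then have "\<rho>\<^sup>2 < 1" by (simp add: power2_eq_square)
  then have c: "c > 0" "c\<^sup>2 = 1 - \<rho>\<^sup>2" by (auto simp: c_def)
  have lnc: "ln c = ln (1 - \<rho>\<^sup>2) / 2" using \<open>\<rho>\<^sup>2 < 1\<close> by (simp add: c_def ln_sqrt)
  define Q where "Q = (\<lambda>y. - ln (1 - \<rho>\<^sup>2) / 2 + (\<rho> * x * y - \<rho>\<^sup>2 * (x\<^sup>2 + y\<^sup>2) / 2) / (1 - \<rho>\<^sup>2))"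
  \<comment> \<open>Given the first component x, the second has mean \<rho> x and variance 1 -
    \<rho>^2; the log-ratio of this conditional density to the standard one is the Mehler
    exponent.\<close>
  have Q: "- ln c + y\<^sup>2 / 2 - ((y - \<rho> * x) / c)\<^sup>2 / 2 = Q y" for y
    unfolding Q_def lnc power_divide c(2) using \<open>\<rho>\<^sup>2 < 1\<close> by (simp add: field_simps power2_eq_square)
  define T where "T = (\<lambda>y. 1 + \<rho> * (x * y) + \<rho>\<^sup>2 / 2 * ((x\<^sup>2 - 1) * (y\<^sup>2 - 1)))"
  have [measurable]: "Q \<in> borel_measurable borel" "T \<in> borel_measurable borel"
    by (simp_all add: Q_def T_def)
  have R: "\<bar>exp (Q y) - T y\<bar> \<le> ((5 * 48 ^ 3) * \<bar>\<rho>\<bar> ^ 3 * exp (3 / 16 * x\<^sup>2)) * exp (3 / 16 * y\<^sup>2)" for y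
    using Mehler_kernel_expansion[OF \<rho>, of x y]
    by (simp add: Q_def T_def distrib_left exp_add mult.assoc)
  note mi = moment_integrable[OF \<tau>]
  have fT: "f (\<tau> * y) * T y = f (\<tau> * y) * 1 + \<rho> * x * (f (\<tau> * y) * y)
      + \<rho>\<^sup>2 / 2 * (x\<^sup>2 - 1) * (f (\<tau> * y) * (y\<^sup>2 - 1))" for y
    by (simp add: T_def field_simps)
  have iT: "integrable \<gamma> (\<lambda>y. f (\<tau> * y) * T y)"
    unfolding fT by (intro Bochner_Integration.integrable_add integrable_mult_right mi)
  have IT: "(\<integral>y. f (\<tau> * y) * T y \<partial>\<gamma>) = moment f (\<lambda>x. 1) \<tau> + \<rho> * x * moment f (\<lambda>x. x) \<tau>
      + \<rho>\<^sup>2 / 2 * (x\<^sup>2 - 1) * moment f (\<lambda>x. x\<^sup>2 - 1) \<tau>"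
    unfolding fT moment_def using mi
    by (simp only: Bochner_Integration.integral_add Bochner_Integration.integrable_add
        integrable_mult_right integral_mult_right_zero)
  have iR: "integrable \<gamma> (\<lambda>y. f (\<tau> * y) * (exp (Q y) - T y))"
    by (rule f_times_integrable[OF \<tau> _ R]) simp
  have "(\<integral>z. f (\<tau> * (\<rho> * x + c * z)) \<partial>\<gamma>) = (\<integral>y. f (\<tau> * y) * exp (Q y) \<partial>\<gamma>)"
    using std_normal_integral_affine[OF _ c(1), of "\<lambda>y. f (\<tau> * y)" "\<rho> * x"] unfolding Q by simp
  also have "\<dots> = (\<integral>y. f (\<tau> * y) * (exp (Q y) - T y) + f (\<tau> * y) * T y \<partial>\<gamma>)"
    by (simp add: algebra_simps)
  also have "\<dots> = (\<integral>y. f (\<tau> * y) * (exp (Q y) - T y) \<partial>\<gamma>) + (\<integral>y. f (\<tau> * y) * T y \<partial>\<gamma>)"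
    using iR iT by (rule Bochner_Integration.integral_add)
  finally show ?thesis
    using f_times_integral_le[OF \<tau> _ R] unfolding IT c_def[symmetric] by (simp add: algebra_simps)
qed

text \<open>The inner remainder still depends on x and grows like
  \<open>exp (3 / 16 * x\<^sup>2)\<close>, exactly the growth allowed for a weight. So the outer
  integration repeats the inner argument with that remainder as the weight.\<close>

lemma pair_expansion:
  assumes \<sigma>: "0 \<le> \<sigma>" "\<sigma> \<le> 2" and \<tau>: "0 \<le> \<tau>" "\<tau> \<le> 2" and \<rho>: "\<bar>\<rho>\<bar> \<le> 1 / 5"
  shows "\<bar>(\<integral>x. f (\<sigma> * x) * (\<integral>z. f (\<tau> * (\<rho> * x + sqrt (1 - \<rho>\<^sup>2) * z)) \<partial>\<gamma>) \<partial>\<gamma>)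
      - (moment f (\<lambda>x. 1) \<sigma> * moment f (\<lambda>x. 1) \<tau> + \<rho> * moment f (\<lambda>x. x) \<sigma> * moment f (\<lambda>x. x) \<tau>
        + \<rho>\<^sup>2 / 2 * moment f (\<lambda>x. x\<^sup>2 - 1) \<sigma> * moment f (\<lambda>x. x\<^sup>2 - 1) \<tau>)\<bar>
    \<le> 64 * K * ((320 * 48 ^ 3) * K * \<bar>\<rho>\<bar> ^ 3)"
proof -
  define H where "H = (\<lambda>x. \<integral>z. f (\<tau> * (\<rho> * x + sqrt (1 - \<rho>\<^sup>2) * z)) \<partial>\<gamma>)"
  define T where "T = (\<lambda>x. moment f (\<lambda>x. 1) \<tau> + \<rho> * x * moment f (\<lambda>x. x) \<tau>
      + \<rho>\<^sup>2 / 2 * (x\<^sup>2 - 1) * moment f (\<lambda>x. x\<^sup>2 - 1) \<tau>)"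
  interpret G: prob_space \<gamma> by (rule prob_space_std_normal)
  have [measurable]: "T \<in> borel_measurable borel" by (simp add: T_def)
  have [measurable]: "H \<in> borel_measurable borel"
    unfolding H_def by (rule G.borel_measurable_lebesgue_integral) simp
  have Hx: "(\<integral>z. f (\<tau> * (\<rho> * x + sqrt (1 - \<rho>\<^sup>2) * z)) \<partial>\<gamma>) = H x" for x
    by (simp add: H_def)
  have R: "\<bar>H x - T x\<bar> \<le> ((320 * 48 ^ 3) * K * \<bar>\<rho>\<bar> ^ 3) * exp (3 / 16 * x\<^sup>2)" for x
    unfolding H_def T_def by (rule pair_expansion_inner[OF \<tau> \<rho>])
  note mi = moment_integrable[OF \<sigma>]
  have fT: "f (\<sigma> * y) * T y = moment f (\<lambda>x. 1) \<tau> * (f (\<sigma> * y) * 1) + \<rho> * moment f (\<lambda>x. x) \<tau> * (f (\<sigma> * y) * y)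
      + \<rho>\<^sup>2 / 2 * moment f (\<lambda>x. x\<^sup>2 - 1) \<tau> * (f (\<sigma> * y) * (y\<^sup>2 - 1))" for y
    by (simp add: T_def field_simps)
  have iT: "integrable \<gamma> (\<lambda>y. f (\<sigma> * y) * T y)"
    unfolding fT by (intro Bochner_Integration.integrable_add integrable_mult_right mi)
  have IT: "(\<integral>y. f (\<sigma> * y) * T y \<partial>\<gamma>) = moment f (\<lambda>x. 1) \<tau> * moment f (\<lambda>x. 1) \<sigma>
      + \<rho> * moment f (\<lambda>x. x) \<tau> * moment f (\<lambda>x. x) \<sigma>
      + \<rho>\<^sup>2 / 2 * moment f (\<lambda>x. x\<^sup>2 - 1) \<tau> * moment f (\<lambda>x. x\<^sup>2 - 1) \<sigma>"
    unfolding fT moment_def[of _ _ \<sigma>] using mi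
    by (simp only: Bochner_Integration.integral_add Bochner_Integration.integrable_add
        integrable_mult_right integral_mult_right_zero)
  have iR: "integrable \<gamma> (\<lambda>y. f (\<sigma> * y) * (H y - T y))"
    by (rule f_times_integrable[OF \<sigma> _ R]) simp
  have "(\<integral>y. f (\<sigma> * y) * H y \<partial>\<gamma>) = (\<integral>y. f (\<sigma> * y) * (H y - T y) + f (\<sigma> * y) * T y \<partial>\<gamma>)"
    by (simp add: algebra_simps)
  also have "\<dots> = (\<integral>y. f (\<sigma> * y) * (H y - T y) \<partial>\<gamma>) + (\<integral>y. f (\<sigma> * y) * T y \<partial>\<gamma>)"
    using iR iT by (rule Bochner_Integration.integral_add)
  finally show ?thesis
    using f_times_integral_le[OF \<sigma> _ R] unfolding IT Hx by (simp add: algebra_simps)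
qed

text \<open>The error is quadratic in \<open>a\<close> although f is only Lipschitz, because the
  expansion is that of the density ratio. The constant is 64 * 4 * 32^2 = 2^18.\<close>

lemma mean_expansion:
  assumes a: "\<bar>a\<bar> \<le> 1 / 5"
  shows "\<bar>moment f (\<lambda>x. 1) (sqrt (1 + a)) - (moment f (\<lambda>x. 1) 1 + a / 2 * moment f (\<lambda>x. x\<^sup>2 - 1) 1)\<bar>
    \<le> 2 ^ 18 * K * a\<^sup>2"
proof -
  define c where "c = sqrt (1 + a)"
  have c: "c > 0" "c\<^sup>2 = 1 + a" using a by (auto simp: c_def)
  have lnc: "ln c = ln (1 + a) / 2" using a by (simp add: c_def ln_sqrt)
  define Q where "Q = (\<lambda>x. - ln (1 + a) / 2 + a * x\<^sup>2 / (2 * (1 + a)))"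
  have Q: "- ln c + y\<^sup>2 / 2 - ((y - 0) / c)\<^sup>2 / 2 = Q y" for y
    unfolding Q_def lnc power_divide c(2) using a by (simp add: field_simps power2_eq_square)
  define T where "T = (\<lambda>x. 1 + a / 2 * (x\<^sup>2 - 1))"
  have [measurable]: "Q \<in> borel_measurable borel" "T \<in> borel_measurable borel"
    by (simp_all add: Q_def T_def)
  have R: "\<bar>exp (Q y) - T y\<bar> \<le> ((4 * 32\<^sup>2) * a\<^sup>2) * exp (3 / 16 * y\<^sup>2)" for y
    unfolding Q_def T_def using variance_change_expansion[OF a] .
  have one: "0 \<le> (1::real)" "(1::real) \<le> 2" by simp_all
  note mi = moment_integrable[OF one]
  have fT: "f (1 * y) * T y = f (1 * y) * 1 + a / 2 * (f (1 * y) * (y\<^sup>2 - 1))" for y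
    by (simp add: T_def field_simps)
  have iT: "integrable \<gamma> (\<lambda>y. f (1 * y) * T y)"
    unfolding fT by (intro Bochner_Integration.integrable_add integrable_mult_right mi)
  have IT: "(\<integral>y. f (1 * y) * T y \<partial>\<gamma>) = moment f (\<lambda>x. 1) 1 + a / 2 * moment f (\<lambda>x. x\<^sup>2 - 1) 1"
    unfolding fT moment_def using mi
    by (simp only: Bochner_Integration.integral_add Bochner_Integration.integrable_add
        integrable_mult_right integral_mult_right_zero)
  have iR: "integrable \<gamma> (\<lambda>y. f (1 * y) * (exp (Q y) - T y))"
    by (rule f_times_integrable[OF one _ R]) simp
  have "moment f (\<lambda>x. 1) c = (\<integral>z. f (0 + c * z) \<partial>\<gamma>)" by (simp add: moment_def)
  also have "\<dots> = (\<integral>y. f y * exp (Q y) \<partial>\<gamma>)"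
    using std_normal_integral_affine[OF f_measurable c(1), of 0] unfolding Q .
  also have "\<dots> = (\<integral>y. f (1 * y) * (exp (Q y) - T y) + f (1 * y) * T y \<partial>\<gamma>)"
    by (simp add: algebra_simps)
  also have "\<dots> = (\<integral>y. f (1 * y) * (exp (Q y) - T y) \<partial>\<gamma>) + (\<integral>y. f (1 * y) * T y \<partial>\<gamma>)"
    using iR iT by (rule Bochner_Integration.integral_add)
  finally show ?thesis
    using f_times_integral_le[OF one _ R] unfolding IT c_def[symmetric] by (simp add: algebra_simps)
qed

section \<open>Lipschitz dependence of the moments on the standard deviation\<close>

lemma diff_le: "\<bar>f (\<sigma> * x) - f (1 * x)\<bar> \<le> K * \<bar>\<sigma> - 1\<bar> * \<bar>x\<bar>"
proof -
  have "\<sigma> * x - 1 * x = (\<sigma> - 1) * x" by (simp add: algebra_simps)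
  then show ?thesis using lip[of "\<sigma> * x" "1 * x"] unfolding mult.assoc abs_mult[symmetric] by simp
qed

text \<open>First-order accuracy suffices for these two moments, since they will multiply a
  covariance or its square. The Lipschitz bound on f is therefore applied directly, without a change
  of density.\<close>

lemma
  assumes \<sigma>: "0 \<le> \<sigma>" "\<sigma> \<le> 2"
  shows moment1_lipschitz: "\<bar>moment f (\<lambda>x. x) \<sigma> - moment f (\<lambda>x. x) 1\<bar> \<le> 512 * K * \<bar>\<sigma> - 1\<bar>"
    and moment2_lipschitz: "\<bar>moment f (\<lambda>x. x\<^sup>2 - 1) \<sigma> - moment f (\<lambda>x. x\<^sup>2 - 1) 1\<bar> \<le> 2048 * K * \<bar>\<sigma> - 1\<bar>"
proof -
  have one: "0 \<le> (1::real)" "(1::real) \<le> 2" by simp_all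
  have mono: "exp (t * x\<^sup>2) \<le> exp (x\<^sup>2 / 4)" if "t \<le> 1 / 4" for t x :: real
    using mult_right_mono[OF that, of "x\<^sup>2"] by simp
  have d: "\<bar>f (\<sigma> * x) - f (1 * x)\<bar> \<le> K * \<bar>\<sigma> - 1\<bar> * \<bar>x\<bar>" for x
    by (rule diff_le)
  have 1: "\<bar>f (\<sigma> * x) * x - f (1 * x) * x\<bar> \<le> (256 * K * \<bar>\<sigma> - 1\<bar>) * exp (x\<^sup>2 / 4)" for x
  proof -
    have "\<bar>f (\<sigma> * x) * x - f (1 * x) * x\<bar> = \<bar>f (\<sigma> * x) - f (1 * x)\<bar> * \<bar>x\<bar>"
      by (simp add: left_diff_distrib[symmetric] abs_mult)
    also have "\<dots> \<le> K * \<bar>\<sigma> - 1\<bar> * \<bar>x\<bar> * \<bar>x\<bar>" by (intro mult_right_mono d) auto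
    also have "\<dots> = K * \<bar>\<sigma> - 1\<bar> * (\<bar>x\<bar> * \<bar>x\<bar>)" by simp
    also have "\<bar>x\<bar> * \<bar>x\<bar> \<le> 256 * exp (x\<^sup>2 / 4)"
      by (rule order_trans[OF weight_bound(4)]) (intro mult_left_mono mono; simp)
    then have "K * \<bar>\<sigma> - 1\<bar> * (\<bar>x\<bar> * \<bar>x\<bar>) \<le> K * \<bar>\<sigma> - 1\<bar> * (256 * exp (x\<^sup>2 / 4))"
      using K_nonneg by (intro mult_left_mono) auto
    finally show ?thesis by simp
  qed
  have 2: "\<bar>f (\<sigma> * x) * (x\<^sup>2 - 1) - f (1 * x) * (x\<^sup>2 - 1)\<bar> \<le> (1024 * K * \<bar>\<sigma> - 1\<bar>) * exp (x\<^sup>2 / 4)" for x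
  proof -
    have "\<bar>f (\<sigma> * x) * (x\<^sup>2 - 1) - f (1 * x) * (x\<^sup>2 - 1)\<bar> = \<bar>f (\<sigma> * x) - f (1 * x)\<bar> * \<bar>x\<^sup>2 - 1\<bar>"
      by (simp add: left_diff_distrib[symmetric] abs_mult)
    also have "\<dots> \<le> K * \<bar>\<sigma> - 1\<bar> * \<bar>x\<bar> * \<bar>x\<^sup>2 - 1\<bar>" by (intro mult_right_mono d) auto
    also have "\<dots> = K * \<bar>\<sigma> - 1\<bar> * (\<bar>x\<bar> * \<bar>x\<^sup>2 - 1\<bar>)" by simp
    also have "\<bar>x\<bar> * \<bar>x\<^sup>2 - 1\<bar> \<le> 1024 * exp (x\<^sup>2 / 4)"
    proof -
      have "0 \<le> (\<bar>x\<bar> - 1)\<^sup>2" by simp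
      then have "\<bar>x\<bar> \<le> 1 + x\<^sup>2" by (simp add: power2_diff)
      moreover have "\<bar>x\<^sup>2 - 1\<bar> \<le> 1 + x\<^sup>2" using zero_le_power2[of x] by linarith
      ultimately have "\<bar>x\<bar> * \<bar>x\<^sup>2 - 1\<bar> \<le> (1 + x\<^sup>2) * (1 + x\<^sup>2)" by (intro mult_mono) auto
      then have "\<bar>x\<bar> * \<bar>x\<^sup>2 - 1\<bar> \<le> (1 + x\<^sup>2)\<^sup>2" by (simp add: power2_eq_square)
      also have "\<dots> \<le> 1024 * exp (x\<^sup>2 / 16)" using one_plus_power_le_exp[of "x\<^sup>2" 2] by simp
      also have "\<dots> \<le> 1024 * exp (x\<^sup>2 / 4)" by (intro mult_left_mono) auto
      finally show ?thesis .
    qed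
    then have "K * \<bar>\<sigma> - 1\<bar> * (\<bar>x\<bar> * \<bar>x\<^sup>2 - 1\<bar>) \<le> K * \<bar>\<sigma> - 1\<bar> * (1024 * exp (x\<^sup>2 / 4))"
      using K_nonneg by (intro mult_left_mono) auto
    finally show ?thesis by simp
  qed
  show "\<bar>moment f (\<lambda>x. x) \<sigma> - moment f (\<lambda>x. x) 1\<bar> \<le> 512 * K * \<bar>\<sigma> - 1\<bar>"
    unfolding moment_def
      Bochner_Integration.integral_diff[OF moment_integrable(2)[OF \<sigma>] moment_integrable(2)[OF one], symmetric]
    using std_normal_dominated_integral[OF _ 1] by simp
  show "\<bar>moment f (\<lambda>x. x\<^sup>2 - 1) \<sigma> - moment f (\<lambda>x. x\<^sup>2 - 1) 1\<bar> \<le> 2048 * K * \<bar>\<sigma> - 1\<bar>"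
    unfolding moment_def
      Bochner_Integration.integral_diff[OF moment_integrable(3)[OF \<sigma>] moment_integrable(3)[OF one], symmetric]
    using std_normal_dominated_integral[OF _ 2] by simp
qed

lemma square_integrable:
  assumes \<sigma>: "0 \<le> \<sigma>" "\<sigma> \<le> 2" shows "integrable \<gamma> (\<lambda>x. (f (\<sigma> * x))\<^sup>2)"
  unfolding power2_eq_square
proof (rule f_times_integrable[OF \<sigma>])
  show "\<bar>f (\<sigma> * x)\<bar> \<le> (32 * K) * exp (3 / 16 * x\<^sup>2)" for x
    by (rule order_trans[OF f_growth[OF \<sigma>]]) (use K_nonneg in \<open>auto intro!: mult_left_mono\<close>)
qed simp

text \<open>In the difference of squares, one factor carries the deviation of the standard deviation
  from 1 and the other the growth of f; each spends 1/16 of the exponent. This estimate serves the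
  diagonal entries.\<close>

lemma square_moment_lipschitz:
  assumes \<sigma>: "0 \<le> \<sigma>" "\<sigma> \<le> 2"
  shows "\<bar>(\<integral>x. (f (\<sigma> * x))\<^sup>2 \<partial>\<gamma>) - (\<integral>x. (f x)\<^sup>2 \<partial>\<gamma>)\<bar> \<le> 2048 * K\<^sup>2 * \<bar>\<sigma> - 1\<bar>"
proof -
  have one: "0 \<le> (1::real)" "(1::real) \<le> 2" by simp_all
  have 1: "\<bar>(f (\<sigma> * x))\<^sup>2 - (f (1 * x))\<^sup>2\<bar> \<le> (1024 * K\<^sup>2 * \<bar>\<sigma> - 1\<bar>) * exp (x\<^sup>2 / 4)" for x
  proof -
    have "0 \<le> (\<bar>x\<bar> - 1)\<^sup>2" by simp
    then have "\<bar>x\<bar> \<le> 1 + x\<^sup>2" by (simp add: power2_diff)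
    also have "\<dots> \<le> 16 * exp (x\<^sup>2 / 16)" by (rule one_plus_le_scaled_exp) simp
    finally have x: "\<bar>x\<bar> \<le> 16 * exp (x\<^sup>2 / 16)" .
    have "\<bar>f (\<sigma> * x) - f (1 * x)\<bar> \<le> K * \<bar>\<sigma> - 1\<bar> * \<bar>x\<bar>"
      by (rule diff_le)
    also have "\<dots> \<le> K * \<bar>\<sigma> - 1\<bar> * (16 * exp (x\<^sup>2 / 16))"
      using x K_nonneg by (intro mult_left_mono) auto
    finally have d: "\<bar>f (\<sigma> * x) - f (1 * x)\<bar> \<le> K * \<bar>\<sigma> - 1\<bar> * (16 * exp (x\<^sup>2 / 16))" .
    have s: "\<bar>f (\<sigma> * x) + f (1 * x)\<bar> \<le> 64 * K * exp (x\<^sup>2 / 16)"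
      using f_growth[OF \<sigma>, of x] f_growth[OF one, of x] by linarith
    have "\<bar>(f (\<sigma> * x))\<^sup>2 - (f (1 * x))\<^sup>2\<bar> = \<bar>f (\<sigma> * x) - f (1 * x)\<bar> * \<bar>f (\<sigma> * x) + f (1 * x)\<bar>"
      by (simp add: abs_mult[symmetric] power2_eq_square algebra_simps)
    also have "\<dots> \<le> K * \<bar>\<sigma> - 1\<bar> * (16 * exp (x\<^sup>2 / 16)) * (64 * K * exp (x\<^sup>2 / 16))"
      using d s K_nonneg by (intro mult_mono) auto
    also have "\<dots> = (1024 * K\<^sup>2 * \<bar>\<sigma> - 1\<bar>) * exp (x\<^sup>2 / 8)"
      by (simp add: power2_eq_square exp_add[symmetric])
    also have "\<dots> \<le> (1024 * K\<^sup>2 * \<bar>\<sigma> - 1\<bar>) * exp (x\<^sup>2 / 4)" by (intro mult_left_mono) auto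
    finally show ?thesis .
  qed
  show ?thesis
    using std_normal_dominated_integral[OF _ 1]
      Bochner_Integration.integral_diff[OF square_integrable[OF \<sigma>] square_integrable[OF one]]
    by simp
qed

text \<open>Here \<open>zeta 0 f = 0\<close> enters: it removes the constant term, which would
  contribute to the kernel a rank-one matrix with constant entries, of norm proportional to
  n.\<close>

lemma coeff0_expansion:
  assumes "zeta 0 f = 0" "\<bar>a\<bar> \<le> 1 / 5"
  shows "\<bar>coeff0 f a - zeta 2 f / sqrt 2 * a\<bar> \<le> 2 ^ 18 * K * a\<^sup>2"
proof -
  have "moment f (\<lambda>x. x\<^sup>2 - 1) 1 = zeta 2 f * sqrt 2" by (simp add: zeta_moment)
  moreover have "sqrt 2 * sqrt 2 = (2::real)" by simp
  ultimately have eq: "a / 2 * moment f (\<lambda>x. x\<^sup>2 - 1) 1 = zeta 2 f / sqrt 2 * a"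
    by (simp add: field_simps)
  have "moment f (\<lambda>x. 1) 1 = 0" using assms(1) zeta_moment(1)[of f] by simp
  then show ?thesis
    using mean_expansion[OF assms(2)] unfolding eq coeff0_def by simp
qed

lemma
  assumes a: "\<bar>a\<bar> \<le> 1 / 5"
  shows coeff1_lipschitz: "\<bar>coeff1 f a - zeta 1 f\<bar> \<le> 2 ^ 16 * K * \<bar>a\<bar>"
    and coeff2_lipschitz: "\<bar>coeff2 f a - zeta 2 f\<bar> \<le> 2 ^ 16 * K * \<bar>a\<bar>"
    and coeff1_bound: "\<bar>coeff1 f a\<bar> \<le> 2 ^ 15 * K"
    and coeff2_bound: "\<bar>coeff2 f a\<bar> \<le> 2 ^ 15 * K"
proof -
  define \<sigma> where "\<sigma> = sqrt (1 + a)"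
  have \<sigma>: "1 / 2 \<le> \<sigma>" "\<sigma> \<le> 2" using sqrt_one_plus_bounds[OF a] by (auto simp: \<sigma>_def)
  have \<sigma>0: "0 \<le> \<sigma>" using \<sigma> by simp
  have \<sigma>1: "\<bar>\<sigma> - 1\<bar> \<le> \<bar>a\<bar>" unfolding \<sigma>_def using a by (intro abs_sqrt_diff_one_le) auto
  \<comment> \<open>Perturbation of a quotient whose denominator is near 1; the lower bound 1/2 on
    the denominator costs the factor 2.\<close>
  have quot: "\<bar>m / d - m1\<bar> \<le> 2 * (\<bar>m - m1\<bar> + \<bar>m1\<bar> * \<bar>d - 1\<bar>)" "\<bar>m / d\<bar> \<le> 2 * \<bar>m\<bar>"
    if "d \<ge> 1 / 2" for m m1 d :: real
  proof -
    have le: "\<bar>z / d\<bar> \<le> 2 * \<bar>z\<bar>" for z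
    proof -
      have "\<bar>z / d\<bar> \<le> \<bar>z\<bar> / (1 / 2)"
        unfolding abs_divide using that by (intro divide_left_mono) auto
      then show ?thesis by simp
    qed
    have "m / d - m1 = ((m - m1) - m1 * (d - 1)) / d" using that by (simp add: field_simps)
    then have "\<bar>m / d - m1\<bar> \<le> 2 * \<bar>(m - m1) - m1 * (d - 1)\<bar>" using le by simp
    also have "\<dots> \<le> 2 * (\<bar>m - m1\<bar> + \<bar>m1\<bar> * \<bar>d - 1\<bar>)"
      unfolding abs_mult[symmetric] by (intro mult_left_mono abs_triangle_ineq4) auto
    finally show "\<bar>m / d - m1\<bar> \<le> 2 * (\<bar>m - m1\<bar> + \<bar>m1\<bar> * \<bar>d - 1\<bar>)" .
    show "\<bar>m / d\<bar> \<le> 2 * \<bar>m\<bar>" by (rule le)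
  qed
  \<comment> \<open>Used with d = \<sigma> for \<open>coeff1\<close> and d = 1 + a for
    \<open>coeff2\<close>. The constant covers 2 * (2048 + 2^14), which is below 2^16.\<close>
  have main: "\<bar>m / d - m1\<bar> \<le> 2 ^ 16 * K * \<bar>a\<bar>"
    if "d \<ge> 1 / 2" "\<bar>d - 1\<bar> \<le> \<bar>a\<bar>" "\<bar>m - m1\<bar> \<le> 2048 * K * \<bar>\<sigma> - 1\<bar>" "\<bar>m1\<bar> \<le> 2 ^ 14 * K"
    for m m1 d
  proof -
    have "\<bar>m - m1\<bar> \<le> 2048 * K * \<bar>a\<bar>"
      by (rule order_trans[OF that(3)]) (use K_nonneg \<sigma>1 in \<open>auto intro!: mult_left_mono\<close>)
    moreover have "\<bar>m1\<bar> * \<bar>d - 1\<bar> \<le> 2 ^ 14 * K * \<bar>a\<bar>"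
      using that K_nonneg by (intro mult_mono) auto
    moreover have "0 \<le> K * \<bar>a\<bar>" using K_nonneg by simp
    ultimately show ?thesis using quot(1)[OF that(1), of m m1] by simp
  qed
  have one: "0 \<le> (1::real)" "(1::real) \<le> 2" by simp_all
  have c1: "coeff1 f a = moment f (\<lambda>x. x) \<sigma> / \<sigma>" by (simp add: coeff1_def \<sigma>_def)
  have "512 * K * \<bar>\<sigma> - 1\<bar> \<le> 2048 * K * \<bar>\<sigma> - 1\<bar>" using K_nonneg by (intro mult_right_mono) auto
  then show "\<bar>coeff1 f a - zeta 1 f\<bar> \<le> 2 ^ 16 * K * \<bar>a\<bar>"
    unfolding c1 zeta_moment
    using moment1_lipschitz[OF \<sigma>0 \<sigma>(2)] moment_bound(2)[OF one] \<sigma>(1) \<sigma>1 by (intro main) auto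
  show "\<bar>coeff1 f a\<bar> \<le> 2 ^ 15 * K"
    unfolding c1 using quot(2)[OF \<sigma>(1), of "moment f (\<lambda>x. x) \<sigma>"] moment_bound(2)[OF \<sigma>0 \<sigma>(2)] by simp
  have root: "\<bar>z / sqrt 2\<bar> \<le> \<bar>z\<bar>" for z :: real
  proof -
    have "\<bar>z\<bar> / sqrt 2 \<le> \<bar>z\<bar> / 1" by (intro divide_left_mono) auto
    then show ?thesis by simp
  qed
  have c2: "coeff2 f a = (moment f (\<lambda>x. x\<^sup>2 - 1) \<sigma> / (1 + a)) / sqrt 2" by (simp add: coeff2_def \<sigma>_def)
  have "\<bar>moment f (\<lambda>x. x\<^sup>2 - 1) \<sigma> / (1 + a) - moment f (\<lambda>x. x\<^sup>2 - 1) 1\<bar> \<le> 2 ^ 16 * K * \<bar>a\<bar>"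
    using moment2_lipschitz[OF \<sigma>0 \<sigma>(2)] moment_bound(3)[OF one] a by (intro main) auto
  then show "\<bar>coeff2 f a - zeta 2 f\<bar> \<le> 2 ^ 16 * K * \<bar>a\<bar>"
    unfolding c2 zeta_moment diff_divide_distrib[symmetric] by (rule order_trans[OF root])
  have "\<bar>moment f (\<lambda>x. x\<^sup>2 - 1) \<sigma> / (1 + a)\<bar> \<le> 2 * \<bar>moment f (\<lambda>x. x\<^sup>2 - 1) \<sigma>\<bar>"
    using a by (intro quot(2)) auto
  also have "\<dots> \<le> 2 * (2 ^ 14 * K)" using moment_bound(3)[OF \<sigma>0 \<sigma>(2)] by (intro mult_left_mono) auto
  also have "\<dots> = 2 ^ 15 * K" by simp
  finally show "\<bar>coeff2 f a\<bar> \<le> 2 ^ 15 * K" unfolding c2 by (rule order_trans[OF root])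
qed

section \<open>Expectations over arbitrary centered Gaussian variables\<close>

lemma gaussian_square_expectation:
  assumes M: "prob_space M" and G: "\<And>a. gaussian_variable M (\<lambda>x. a * X x)"
    and mean: "(\<integral>x. X x \<partial>M) = 0" and var: "(\<integral>x. (X x)\<^sup>2 \<partial>M) = 1 + a" and a: "\<bar>a\<bar> \<le> 1 / 5"
  shows "\<bar>(\<integral>x. (f (X x))\<^sup>2 \<partial>M) - (H_norm f)\<^sup>2\<bar> \<le> 2048 * K\<^sup>2 * \<bar>a\<bar>"
proof -
  interpret prob_space M by fact
  have [measurable]: "X \<in> borel_measurable M" using G[of 1] by (simp add: gaussian_variable_def)
  define \<sigma> where "\<sigma> = sqrt (1 + a)"
  have \<sigma>: "0 < \<sigma>" "\<sigma> \<le> 2" "\<sigma>\<^sup>2 = 1 + a" using sqrt_one_plus_bounds[OF a] a by (auto simp: \<sigma>_def)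
  have \<sigma>1: "\<bar>\<sigma> - 1\<bar> \<le> \<bar>a\<bar>" unfolding \<sigma>_def using a by (intro abs_sqrt_diff_one_le) auto
  have D: "distr M borel (\<lambda>x. X x / \<sigma>) = \<gamma>"
    using var \<sigma> by (intro gaussian_variable_standardized[OF M G mean]) auto
  have "(\<integral>x. (f (\<sigma> * x))\<^sup>2 \<partial>distr M borel (\<lambda>x. X x / \<sigma>)) = (\<integral>x. (f (\<sigma> * (X x / \<sigma>)))\<^sup>2 \<partial>M)"
    by (subst integral_distr) auto
  then have "(\<integral>x. (f (X x))\<^sup>2 \<partial>M) = (\<integral>x. (f (\<sigma> * x))\<^sup>2 \<partial>\<gamma>)" using \<sigma>(1) unfolding D by simp
  moreover have "(H_norm f)\<^sup>2 = (\<integral>x. (f x)\<^sup>2 \<partial>\<gamma>)"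
    unfolding H_norm_def by (intro real_sqrt_pow2 integral_nonneg_AE) auto
  moreover have "2048 * K\<^sup>2 * \<bar>\<sigma> - 1\<bar> \<le> 2048 * K\<^sup>2 * \<bar>a\<bar>" using \<sigma>1 by (intro mult_left_mono) auto
  moreover have "\<bar>(\<integral>x. (f (\<sigma> * x))\<^sup>2 \<partial>\<gamma>) - (\<integral>x. (f x)\<^sup>2 \<partial>\<gamma>)\<bar> \<le> 2048 * K\<^sup>2 * \<bar>\<sigma> - 1\<bar>"
    using \<sigma> by (intro square_moment_lipschitz) auto
  ultimately show ?thesis by simp
qed

text \<open>The product is a function of the decorrelated pair, whose law is a product measure, so
  Fubini's theorem yields the iterated integral.\<close>

lemma gaussian_pair_product_expectation:
  assumes M: "prob_space M" and G: "\<And>a b. gaussian_variable M (\<lambda>x. a * X x + b * Y x)"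
    and mean: "(\<integral>x. X x \<partial>M) = 0" "(\<integral>x. Y x \<partial>M) = 0"
    and var: "(\<integral>x. (X x)\<^sup>2 \<partial>M) = \<sigma>\<^sup>2" "(\<integral>x. (Y x)\<^sup>2 \<partial>M) = \<tau>\<^sup>2"
    and cov: "(\<integral>x. X x * Y x \<partial>M) = \<sigma> * \<tau> * \<rho>"
    and pos: "0 < \<sigma>" "0 < \<tau>" "\<bar>\<rho>\<bar> < 1" and le2: "\<sigma> \<le> 2" "\<tau> \<le> 2"
  shows "(\<integral>x. f (X x) * f (Y x) \<partial>M)
    = (\<integral>x. f (\<sigma> * x) * (\<integral>z. f (\<tau> * (\<rho> * x + sqrt (1 - \<rho>\<^sup>2) * z)) \<partial>\<gamma>) \<partial>\<gamma>)"
proof -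
  interpret prob_space M by fact
  interpret G: prob_space \<gamma> by (rule prob_space_std_normal)
  interpret GG: pair_sigma_finite \<gamma> \<gamma> by unfold_locales
  have GX: "gaussian_variable M X" and GY: "gaussian_variable M Y" using G[of 1 0] G[of 0 1] by simp_all
  have [measurable]: "X \<in> borel_measurable M" "Y \<in> borel_measurable M"
    using GX GY by (simp_all add: gaussian_variable_def)
  define r where "r = sqrt (1 - \<rho>\<^sup>2)"
  have "\<rho>\<^sup>2 < 1" using pos(3) by (simp add: abs_square_less_1)
  then have r: "r > 0" by (auto simp: r_def)
  define U where "U = (\<lambda>x. (X x / \<sigma>, (Y x / \<tau> - \<rho> * (X x / \<sigma>)) / r))"
  have [measurable]: "U \<in> M \<rightarrow>\<^sub>M \<gamma> \<Otimes>\<^sub>M \<gamma>" by (simp add: U_def)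
  have D: "distr M (\<gamma> \<Otimes>\<^sub>M \<gamma>) U = \<gamma> \<Otimes>\<^sub>M \<gamma>"
    unfolding U_def r_def by (rule gaussian_pair_decorrelated[OF M G mean var cov pos])
  define F where "F = (\<lambda>(x, z). f (\<sigma> * x) * f (\<tau> * (\<rho> * x + r * z)))"
  have [measurable]: "F \<in> borel_measurable (\<gamma> \<Otimes>\<^sub>M \<gamma>)" by (simp add: F_def)
  have FU: "F (U x) = f (X x) * f (Y x)" for x
  proof -
    have "\<rho> * (X x / \<sigma>) + r * ((Y x / \<tau> - \<rho> * (X x / \<sigma>)) / r) = Y x / \<tau>" using r by simp
    moreover have "\<sigma> * (X x / \<sigma>) = X x" "\<tau> * (Y x / \<tau>) = Y x" using pos by simp_all
    ultimately show ?thesis unfolding F_def U_def prod.case by (simp only:)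
  qed
  \<comment> \<open>Integrability is easiest on the original space, where linear growth of f and
    finite second moments suffice; it is then transported to the product measure.\<close>
  have sq: "integrable M (\<lambda>x. (f (Z x))\<^sup>2)"
    if GZ: "gaussian_variable M Z" for Z
  proof -
    have [measurable]: "Z \<in> borel_measurable M" using GZ by (simp add: gaussian_variable_def)
    have "integrable M (\<lambda>x. 2 * K\<^sup>2 * (1 + (Z x)\<^sup>2))"
      using gaussian_variable_square_integrable[OF M GZ] by simp
    then show ?thesis
    proof (rule Bochner_Integration.integrable_bound)
      have "(f z)\<^sup>2 \<le> 2 * K\<^sup>2 * (1 + z\<^sup>2)" for z
      proof -
        have "\<bar>f z\<bar> \<le> K * (1 + \<bar>z\<bar>)" using lip[of z 0] f0 by (simp add: algebra_simps)
        then have "\<bar>f z\<bar>\<^sup>2 \<le> (K * (1 + \<bar>z\<bar>))\<^sup>2" by (intro power_mono) auto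
        also have "\<dots> = K\<^sup>2 * (1 + \<bar>z\<bar>)\<^sup>2" by (simp add: power_mult_distrib)
        also have "(1 + \<bar>z\<bar>)\<^sup>2 \<le> 2 * (1 + z\<^sup>2)"
          using zero_le_power2[of "\<bar>z\<bar> - 1"] unfolding power2_sum power2_diff by simp
        then have "K\<^sup>2 * (1 + \<bar>z\<bar>)\<^sup>2 \<le> K\<^sup>2 * (2 * (1 + z\<^sup>2))" by (intro mult_left_mono) auto
        finally show ?thesis by (simp add: algebra_simps)
      qed
      then show "AE x in M. norm ((f (Z x))\<^sup>2) \<le> norm (2 * K\<^sup>2 * (1 + (Z x)\<^sup>2))"
        by (auto simp: abs_mult)
    qed simp
  qed
  have "integrable M (\<lambda>x. F (U x))" unfolding FU
  proof (rule Bochner_Integration.integrable_bound)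
    show "integrable M (\<lambda>x. (f (X x))\<^sup>2 + (f (Y x))\<^sup>2)" using sq[OF GX] sq[OF GY] by simp
    show "AE x in M. norm (f (X x) * f (Y x)) \<le> norm ((f (X x))\<^sup>2 + (f (Y x))\<^sup>2)"
      using abs_mult_le_sum_squares by auto
  qed simp
  then have "integrable (distr M (\<gamma> \<Otimes>\<^sub>M \<gamma>) U) F" by (subst integrable_distr_eq) auto
  then have iF: "integrable (\<gamma> \<Otimes>\<^sub>M \<gamma>) F" unfolding D .
  have "(\<integral>x. f (X x) * f (Y x) \<partial>M) = (\<integral>p. F p \<partial>distr M (\<gamma> \<Otimes>\<^sub>M \<gamma>) U)"
    by (subst integral_distr) (auto simp: FU)
  also have "\<dots> = (\<integral>x. \<integral>z. F (x, z) \<partial>\<gamma> \<partial>\<gamma>)"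
    unfolding D by (rule GG.integral_fst'[symmetric, OF iF])
  finally show ?thesis by (simp add: F_def r_def)
qed

text \<open>Only one of the three factors |c| in the cubic remainder is replaced by
  \<open>e\<close>. Keeping c^2 is essential: it is what can be summed along a row.\<close>

lemma gaussian_pair_covariance_expansion:
  assumes M: "prob_space M" and G: "\<And>a b. gaussian_variable M (\<lambda>x. a * X x + b * Y x)"
    and mean: "(\<integral>x. X x \<partial>M) = 0" "(\<integral>x. Y x \<partial>M) = 0"
    and var: "(\<integral>x. (X x)\<^sup>2 \<partial>M) = 1 + a" "(\<integral>x. (Y x)\<^sup>2 \<partial>M) = 1 + b"
    and cov: "(\<integral>x. X x * Y x \<partial>M) = c"
    and e: "\<bar>a\<bar> \<le> e" "\<bar>b\<bar> \<le> e" "\<bar>c\<bar> \<le> e" "e \<le> 1 / 20"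
  shows "\<bar>(\<integral>x. f (X x) * f (Y x) \<partial>M)
      - (coeff0 f a * coeff0 f b + coeff1 f a * coeff1 f b * c + (zeta 2 f)\<^sup>2 * c\<^sup>2)\<bar>
    \<le> 2 ^ 50 * K\<^sup>2 * e * c\<^sup>2"
proof -
  define \<sigma> where "\<sigma> = sqrt (1 + a)"
  define \<tau> where "\<tau> = sqrt (1 + b)"
  define \<rho> where "\<rho> = c / (\<sigma> * \<tau>)"
  have e0: "0 \<le> e" using e(1) by linarith
  have a: "\<bar>a\<bar> \<le> 1 / 5" and b: "\<bar>b\<bar> \<le> 1 / 5" using e by auto
  have \<sigma>: "1 / 2 \<le> \<sigma>" "\<sigma> \<le> 2" "\<sigma>\<^sup>2 = 1 + a" using sqrt_one_plus_bounds[OF a] a by (auto simp: \<sigma>_def)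
  have \<tau>: "1 / 2 \<le> \<tau>" "\<tau> \<le> 2" "\<tau>\<^sup>2 = 1 + b" using sqrt_one_plus_bounds[OF b] b by (auto simp: \<tau>_def)
  have pos: "0 < \<sigma>" "0 < \<tau>" "0 \<le> \<sigma>" "0 \<le> \<tau>" using \<sigma> \<tau> by auto
  have st: "1 / 4 \<le> \<sigma> * \<tau>" using mult_mono[OF \<sigma>(1) \<tau>(1)] pos by simp
  \<comment> \<open>The bound 1/20 on \<open>e\<close> comes from here: both standard deviations are
    at least 1/2, so |\<rho>| is at most 4 |c|, hence at most 1/5.\<close>
  have \<rho>: "\<bar>\<rho>\<bar> \<le> 4 * \<bar>c\<bar>"
  proof -
    have "\<bar>\<rho>\<bar> = \<bar>c\<bar> / (\<sigma> * \<tau>)" using pos by (simp add: \<rho>_def abs_mult)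
    also have "\<dots> \<le> \<bar>c\<bar> / (1 / 4)" using st by (intro divide_left_mono) auto
    finally show ?thesis by simp
  qed
  then have \<rho>5: "\<bar>\<rho>\<bar> \<le> 1 / 5" using e by linarith
  have "\<bar>\<rho>\<bar> ^ 3 \<le> (4 * \<bar>c\<bar>) ^ 3" using \<rho> by (intro power_mono) auto
  also have "\<dots> = 64 * (\<bar>c\<bar> * c\<^sup>2)" by (simp add: power_mult_distrib eval_nat_numeral)
  also have "\<dots> \<le> 64 * (e * c\<^sup>2)" using e by (intro mult_left_mono mult_right_mono) auto
  finally have \<rho>3: "\<bar>\<rho>\<bar> ^ 3 \<le> 64 * (e * c\<^sup>2)" .
  have c: "\<sigma> * \<tau> * \<rho> = c" using pos by (simp add: \<rho>_def)
  define I where "I = (\<integral>x. f (X x) * f (Y x) \<partial>M)"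
  have I: "I = (\<integral>x. f (\<sigma> * x) * (\<integral>z. f (\<tau> * (\<rho> * x + sqrt (1 - \<rho>\<^sup>2) * z)) \<partial>\<gamma>) \<partial>\<gamma>)"
    unfolding I_def using \<sigma> \<tau> \<rho>5 pos c var cov
    by (intro gaussian_pair_product_expectation[OF M G mean]) auto
  have c1: "\<rho> * moment f (\<lambda>x. x) \<sigma> * moment f (\<lambda>x. x) \<tau> = coeff1 f a * coeff1 f b * c"
    using pos unfolding coeff1_def \<sigma>_def[symmetric] \<tau>_def[symmetric] by (simp add: \<rho>_def)
  have "coeff2 f a = moment f (\<lambda>x. x\<^sup>2 - 1) \<sigma> / \<sigma>\<^sup>2 / sqrt 2"
    and "coeff2 f b = moment f (\<lambda>x. x\<^sup>2 - 1) \<tau> / \<tau>\<^sup>2 / sqrt 2"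
    unfolding coeff2_def \<sigma>(3) \<tau>(3) by (simp_all add: \<sigma>_def \<tau>_def)
  moreover have "x / sqrt 2 * (y / sqrt 2) = x * y / 2" for x y :: real by simp
  ultimately have "coeff2 f a * coeff2 f b = moment f (\<lambda>x. x\<^sup>2 - 1) \<sigma> / \<sigma>\<^sup>2 * (moment f (\<lambda>x. x\<^sup>2 - 1) \<tau> / \<tau>\<^sup>2) / 2"
    by (simp only:)
  then have c2: "\<rho>\<^sup>2 / 2 * moment f (\<lambda>x. x\<^sup>2 - 1) \<sigma> * moment f (\<lambda>x. x\<^sup>2 - 1) \<tau> = coeff2 f a * coeff2 f b * c\<^sup>2"
    by (simp add: \<rho>_def power_divide power_mult_distrib)
  have 1: "\<bar>I - (coeff0 f a * coeff0 f b + coeff1 f a * coeff1 f b * c + coeff2 f a * coeff2 f b * c\<^sup>2)\<bar>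
      \<le> 64 * K * ((320 * 48 ^ 3) * K * \<bar>\<rho>\<bar> ^ 3)"
    using pair_expansion[OF pos(3) \<sigma>(2) pos(4) \<tau>(2) \<rho>5]
    unfolding I c1 c2 coeff0_def \<sigma>_def[symmetric] \<tau>_def[symmetric] .
  \<comment> \<open>The exact product of the numerical factors is below 2^38; the power of two is
    rounded up generously.\<close>
  have 2: "64 * K * ((320 * 48 ^ 3) * K * \<bar>\<rho>\<bar> ^ 3) \<le> 2 ^ 49 * K\<^sup>2 * (e * c\<^sup>2)"
  proof -
    have "64 * K * ((320 * 48 ^ 3) * K * \<bar>\<rho>\<bar> ^ 3) = (64 * 320 * 48 ^ 3) * (K\<^sup>2 * \<bar>\<rho>\<bar> ^ 3)"
      by (simp add: power2_eq_square)
    also have "\<dots> \<le> (64 * 320 * 48 ^ 3) * (K\<^sup>2 * (64 * (e * c\<^sup>2)))"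
      using \<rho>3 by (intro mult_left_mono) auto
    also have "\<dots> = (64 * 320 * 48 ^ 3 * 64) * (K\<^sup>2 * (e * c\<^sup>2))" by simp
    also have "\<dots> \<le> 2 ^ 49 * (K\<^sup>2 * (e * c\<^sup>2))" using e0 by (intro mult_right_mono) auto
    finally show ?thesis by simp
  qed
  have z2: "\<bar>zeta 2 f\<bar> \<le> 2 ^ 15 * K"
    using coeff2_bound[of 0] by (simp add: coeff2_def zeta_moment)
  have n: "\<bar>coeff2 f x - zeta 2 f\<bar> \<le> 2 ^ 16 * K * e" if "\<bar>x\<bar> \<le> e" for x
  proof -
    have "\<bar>x\<bar> \<le> 1 / 5" using that e by simp
    moreover have "2 ^ 16 * K * \<bar>x\<bar> \<le> 2 ^ 16 * K * e" using that K_nonneg by (intro mult_left_mono) auto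
    ultimately show ?thesis using coeff2_lipschitz[of x] by linarith
  qed
  have "coeff2 f a * coeff2 f b - (zeta 2 f)\<^sup>2
      = (coeff2 f a - zeta 2 f) * coeff2 f b + zeta 2 f * (coeff2 f b - zeta 2 f)"
    by (simp add: algebra_simps power2_eq_square)
  also have "\<bar>\<dots>\<bar> \<le> \<bar>coeff2 f a - zeta 2 f\<bar> * \<bar>coeff2 f b\<bar> + \<bar>zeta 2 f\<bar> * \<bar>coeff2 f b - zeta 2 f\<bar>"
    unfolding abs_mult[symmetric] by (rule abs_triangle_ineq)
  also have "\<dots> \<le> (2 ^ 16 * K * e) * (2 ^ 15 * K) + (2 ^ 15 * K) * (2 ^ 16 * K * e)"
    using n e z2 coeff2_bound[OF b] K_nonneg e0 by (intro add_mono mult_mono) auto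
  also have "\<dots> = 2 ^ 32 * K\<^sup>2 * e" by (simp add: power2_eq_square)
  finally have "\<bar>coeff2 f a * coeff2 f b - (zeta 2 f)\<^sup>2\<bar> * c\<^sup>2 \<le> 2 ^ 32 * K\<^sup>2 * e * c\<^sup>2"
    by (rule mult_right_mono) simp
  then have 3: "\<bar>coeff2 f a * coeff2 f b * c\<^sup>2 - (zeta 2 f)\<^sup>2 * c\<^sup>2\<bar> \<le> 2 ^ 32 * (K\<^sup>2 * (e * c\<^sup>2))"
    by (simp add: left_diff_distrib[symmetric] abs_mult)
  have nn: "0 \<le> K\<^sup>2 * (e * c\<^sup>2)" using e0 by simp
  have tri: "\<bar>i - (u + w)\<bar> \<le> 2 ^ 50 * t"
    if "\<bar>i - (u + v)\<bar> \<le> 2 ^ 49 * t" "\<bar>v - w\<bar> \<le> 2 ^ 32 * t" "0 \<le> t" for i u v w t :: real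
    using that by simp
  have "\<bar>I - (coeff0 f a * coeff0 f b + coeff1 f a * coeff1 f b * c + (zeta 2 f)\<^sup>2 * c\<^sup>2)\<bar>
      \<le> 2 ^ 50 * (K\<^sup>2 * (e * c\<^sup>2))"
    by (rule tri[OF _ 3 nn]) (use order_trans[OF 1 2] in \<open>simp add: mult.assoc\<close>)
  then show ?thesis by (simp add: I_def mult.assoc)
qed

end

subsection \<open>Operator norm bounds\<close>

text \<open>Stated for an arbitrary upper bound and for entry functions, so that estimates combine
  without suprema or dimension conditions. Only entries with indices below n matter.\<close>

definition op_bound :: "nat \<Rightarrow> (nat \<Rightarrow> nat \<Rightarrow> real) \<Rightarrow> real \<Rightarrow> bool" where
  "op_bound n A c \<longleftrightarrow>
     (\<forall>v. L2_set (\<lambda>i. \<Sum>j<n. A i j * v j) {..<n} \<le> c * L2_set v {..<n})"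

lemma op_bound_mono: "op_bound n A c \<Longrightarrow> c \<le> d \<Longrightarrow> op_bound n A d"
  unfolding op_bound_def by (meson L2_set_nonneg mult_right_mono order_trans)

lemma op_bound_add:
  assumes "op_bound n A c" "op_bound n B d"
  shows "op_bound n (\<lambda>i j. A i j + B i j) (c + d)"
  unfolding op_bound_def
proof
  fix v
  have "L2_set (\<lambda>i. \<Sum>j<n. (A i j + B i j) * v j) {..<n}
      = L2_set (\<lambda>i. (\<Sum>j<n. A i j * v j) + (\<Sum>j<n. B i j * v j)) {..<n}"
    by (simp add: algebra_simps sum.distrib)
  also have "\<dots> \<le> L2_set (\<lambda>i. \<Sum>j<n. A i j * v j) {..<n} + L2_set (\<lambda>i. \<Sum>j<n. B i j * v j) {..<n}"
    by (rule L2_set_triangle_ineq)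
  also have "\<dots> \<le> c * L2_set v {..<n} + d * L2_set v {..<n}"
    using assms by (intro add_mono) (auto simp: op_bound_def)
  finally show "L2_set (\<lambda>i. \<Sum>j<n. (A i j + B i j) * v j) {..<n} \<le> (c + d) * L2_set v {..<n}"
    by (simp add: algebra_simps)
qed

lemma op_bound_cong:
  assumes "\<And>i j. i < n \<Longrightarrow> j < n \<Longrightarrow> A i j = A' i j"
  shows "op_bound n A c \<longleftrightarrow> op_bound n A' c"
proof -
  have "L2_set (\<lambda>i. \<Sum>j<n. A i j * v j) {..<n} = L2_set (\<lambda>i. \<Sum>j<n. A' i j * v j) {..<n}" for v
    using assms by (intro L2_set_cong refl sum.cong) auto
  then show ?thesis by (simp add: op_bound_def)
qed

lemma L2_set_abs: "L2_set (\<lambda>i. \<bar>g i\<bar>) A = L2_set g A"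
  by (simp add: L2_set_def)

lemma L2_set_scale_le:
  assumes "\<And>i. i \<in> A \<Longrightarrow> \<bar>a i\<bar> \<le> d" "d \<ge> 0"
  shows "L2_set (\<lambda>i. a i * v i) A \<le> d * L2_set v A"
proof -
  have "L2_set (\<lambda>i. a i * v i) A = L2_set (\<lambda>i. \<bar>a i * v i\<bar>) A" by (simp add: L2_set_abs)
  also have "\<dots> \<le> L2_set (\<lambda>i. d * \<bar>v i\<bar>) A"
    using assms by (intro L2_set_mono) (auto simp: abs_mult mult_right_mono)
  also have "\<dots> = d * L2_set v A" by (simp only: L2_set_right_distrib[OF assms(2), symmetric] L2_set_abs)
  finally show ?thesis .
qed

text \<open>The matrix is the product diag(a) A diag(b).\<close>

lemma op_bound_diag_scaling:
  assumes A: "op_bound n A c" and "c \<ge> 0"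
    and a: "\<And>i. i < n \<Longrightarrow> \<bar>a i\<bar> \<le> d" and b: "\<And>i. i < n \<Longrightarrow> \<bar>b i\<bar> \<le> e" and "d \<ge> 0" "e \<ge> 0"
  shows "op_bound n (\<lambda>i j. a i * b j * A i j) (d * e * c)"
  unfolding op_bound_def
proof
  fix v
  have "L2_set (\<lambda>i. \<Sum>j<n. a i * b j * A i j * v j) {..<n}
      = L2_set (\<lambda>i. a i * (\<Sum>j<n. A i j * (b j * v j))) {..<n}"
    by (simp add: sum_distrib_left mult_ac)
  also have "\<dots> \<le> d * L2_set (\<lambda>i. \<Sum>j<n. A i j * (b j * v j)) {..<n}"
    using assms by (intro L2_set_scale_le) auto
  also have "\<dots> \<le> d * (c * L2_set (\<lambda>j. b j * v j) {..<n})"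
    using A \<open>d \<ge> 0\<close> by (intro mult_left_mono) (auto simp: op_bound_def)
  also have "\<dots> \<le> d * (c * (e * L2_set v {..<n}))"
    using assms by (intro mult_left_mono L2_set_scale_le) auto
  finally show "L2_set (\<lambda>i. \<Sum>j<n. a i * b j * A i j * v j) {..<n} \<le> d * e * c * L2_set v {..<n}"
    by (simp add: mult_ac)
qed

lemma op_bound_rank_one:
  "op_bound n (\<lambda>i j. a i * b j) (L2_set a {..<n} * L2_set b {..<n})"
  unfolding op_bound_def
proof
  fix v
  have "L2_set (\<lambda>i. \<Sum>j<n. a i * b j * v j) {..<n} = L2_set (\<lambda>i. a i * (\<Sum>j<n. b j * v j)) {..<n}"
    by (simp add: sum_distrib_left mult_ac)
  also have "\<dots> = L2_set (\<lambda>i. \<bar>a i * (\<Sum>j<n. b j * v j)\<bar>) {..<n}" by (simp only: L2_set_abs)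
  also have "\<dots> = L2_set a {..<n} * \<bar>\<Sum>j<n. b j * v j\<bar>"
    by (simp add: L2_set_def power_mult_distrib sum_distrib_right[symmetric] real_sqrt_mult)
  also have "\<dots> \<le> L2_set a {..<n} * (L2_set b {..<n} * L2_set v {..<n})"
  proof (intro mult_left_mono)
    have "\<bar>\<Sum>j<n. b j * v j\<bar> \<le> (\<Sum>j<n. \<bar>b j\<bar> * \<bar>v j\<bar>)"
      by (rule order_trans[OF sum_abs]) (simp add: abs_mult)
    also have "\<dots> \<le> L2_set b {..<n} * L2_set v {..<n}" by (rule L2_set_mult_ineq)
    finally show "\<bar>\<Sum>j<n. b j * v j\<bar> \<le> L2_set b {..<n} * L2_set v {..<n}" .
  qed simp
  finally show "L2_set (\<lambda>i. \<Sum>j<n. a i * b j * v j) {..<n}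
      \<le> L2_set a {..<n} * L2_set b {..<n} * L2_set v {..<n}"
    by (simp only: mult.assoc)
qed

text \<open>Splitting |A_ij| into two square roots, Cauchy-Schwarz yields a row sum times the sum of
  |A_ij| v_j^2 over j; summing over i then produces column sums.\<close>

lemma op_bound_Schur_test:
  assumes row: "\<And>i. i < n \<Longrightarrow> (\<Sum>j<n. \<bar>A i j\<bar>) \<le> r"
    and col: "\<And>j. j < n \<Longrightarrow> (\<Sum>i<n. \<bar>A i j\<bar>) \<le> r" and "r \<ge> 0"
  shows "op_bound n A r"
  unfolding op_bound_def
proof
  fix v :: "nat \<Rightarrow> real"
  have CS: "(\<Sum>j<n. A i j * v j)\<^sup>2 \<le> r * (\<Sum>j<n. \<bar>A i j\<bar> * (v j)\<^sup>2)" if "i < n" for i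
  proof -
    have "(\<Sum>j<n. A i j * v j)\<^sup>2 = \<bar>\<Sum>j<n. A i j * v j\<bar>\<^sup>2" by simp
    also have "\<dots> \<le> (\<Sum>j<n. sqrt \<bar>A i j\<bar> * (sqrt \<bar>A i j\<bar> * \<bar>v j\<bar>))\<^sup>2"
      by (intro power_mono order_trans[OF sum_abs] sum_mono) (auto simp: abs_mult mult.assoc[symmetric])
    also have "\<dots> \<le> (\<Sum>j<n. (sqrt \<bar>A i j\<bar>)\<^sup>2) * (\<Sum>j<n. (sqrt \<bar>A i j\<bar> * \<bar>v j\<bar>)\<^sup>2)"
      by (rule Cauchy_Schwarz_ineq_sum)
    also have "\<dots> \<le> r * (\<Sum>j<n. \<bar>A i j\<bar> * (v j)\<^sup>2)"
      using row[OF that] by (auto simp: power_mult_distrib intro!: mult_right_mono sum_nonneg)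
    finally show ?thesis .
  qed
  have "(\<Sum>i<n. (\<Sum>j<n. A i j * v j)\<^sup>2) \<le> (\<Sum>i<n. r * (\<Sum>j<n. \<bar>A i j\<bar> * (v j)\<^sup>2))"
    by (intro sum_mono CS) auto
  also have "\<dots> = r * (\<Sum>j<n. (\<Sum>i<n. \<bar>A i j\<bar>) * (v j)\<^sup>2)"
    by (subst sum_distrib_left[symmetric], subst sum.swap) (simp add: sum_distrib_right)
  also have "\<dots> \<le> r * (\<Sum>j<n. r * (v j)\<^sup>2)"
    using col \<open>r \<ge> 0\<close> by (intro mult_left_mono sum_mono mult_right_mono) auto
  also have "\<dots> = r\<^sup>2 * (\<Sum>j<n. (v j)\<^sup>2)" by (simp add: sum_distrib_left power2_eq_square mult_ac)
  finally have "sqrt (\<Sum>i<n. (\<Sum>j<n. A i j * v j)\<^sup>2) \<le> sqrt (r\<^sup>2 * (\<Sum>j<n. (v j)\<^sup>2))"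
    by (rule real_sqrt_le_mono)
  then show "L2_set (\<lambda>i. \<Sum>j<n. A i j * v j) {..<n} \<le> r * L2_set v {..<n}"
    using \<open>r \<ge> 0\<close> by (simp add: L2_set_def real_sqrt_mult)
qed

text \<open>The bound is tested on the k-th unit vector.\<close>

lemma op_bound_column:
  assumes "op_bound n A c" "k < n"
  shows "(\<Sum>i<n. (A i k)\<^sup>2) \<le> c\<^sup>2"
proof -
  have 1: "(\<Sum>j<n. A i j * (if j = k then 1 else 0)) = A i k" for i
    using assms(2) by (simp add: if_distrib cong: if_cong)
  have 2: "(\<Sum>j<n. (if j = k then 1 else 0 :: real)\<^sup>2) = 1"
    using assms(2) by (simp add: if_distrib[of "\<lambda>x. x\<^sup>2"] cong: if_cong)
  have "sqrt (\<Sum>i<n. (A i k)\<^sup>2) \<le> c"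
    using assms(1)[unfolded op_bound_def, rule_format, of "\<lambda>j. if j = k then 1 else 0"]
    unfolding L2_set_def 1 2 by simp
  then show ?thesis by (rule sqrt_le_D)
qed

section \<open>The spectral norm as an operator bound\<close>

lemma euclid_norm_eq_L2_set: "euclid_norm v = L2_set (\<lambda>i. v $ i) {..<dim_vec v}"
  by (simp add: euclid_norm_def L2_set_def scalar_prod_def power2_eq_square atLeast0LessThan)

lemma euclid_norm_mult_mat_vec:
  assumes "A \<in> carrier_mat n n" "v \<in> carrier_vec n"
  shows "euclid_norm (A *\<^sub>v v) = L2_set (\<lambda>i. \<Sum>j<n. A $$ (i, j) * v $ j) {..<n}"
  using assms by (auto simp: euclid_norm_eq_L2_set scalar_prod_def atLeast0LessThan intro!: L2_set_cong)

lemma op_bound_spectral_norm: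
  assumes A: "A \<in> carrier_mat n n"
  shows "op_bound n (\<lambda>i j. A $$ (i, j)) (spectral_norm A)"
  unfolding op_bound_def
proof
  fix v :: "nat \<Rightarrow> real"
  define l where "l = L2_set v {..<n}"
  \<comment> \<open>A crude bound by the sum of all absolute entries. It makes the set in
    \<open>spectral_norm\<close> bounded above, so that the supremum dominates its elements, and it
    settles vectors of norm zero, which cannot be normalized.\<close>
  define r where "r = (\<Sum>i<n. \<Sum>j<n. \<bar>A $$ (i, j)\<bar>)"
  have r: "op_bound n (\<lambda>i j. A $$ (i, j)) r"
  proof (rule op_bound_Schur_test)
    show "r \<ge> 0" unfolding r_def by (intro sum_nonneg) auto
    show "(\<Sum>j<n. \<bar>A $$ (i, j)\<bar>) \<le> r" if "i < n" for i
      unfolding r_def using that by (intro member_le_sum) (auto intro: sum_nonneg)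
    show "(\<Sum>i<n. \<bar>A $$ (i, j)\<bar>) \<le> r" if "j < n" for j
      unfolding r_def by (subst sum.swap, rule member_le_sum) (use that in \<open>auto intro: sum_nonneg\<close>)
  qed
  let ?U = "{v \<in> carrier_vec (dim_col A). euclid_norm v \<le> 1}"
  have bdd: "bdd_above ((\<lambda>v. euclid_norm (A *\<^sub>v v)) ` ?U)"
  proof (rule bdd_aboveI2)
    fix w assume w: "w \<in> ?U"
    then have "euclid_norm (A *\<^sub>v w) \<le> r * euclid_norm w"
      using A r by (subst euclid_norm_mult_mat_vec[OF A]) (auto simp: op_bound_def euclid_norm_eq_L2_set)
    also have "\<dots> \<le> \<bar>r\<bar> * 1"
      using w by (intro mult_mono) (auto simp: euclid_norm_eq_L2_set)
    finally show "euclid_norm (A *\<^sub>v w) \<le> \<bar>r\<bar>" by simp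
  qed
  show "L2_set (\<lambda>i. \<Sum>j<n. A $$ (i, j) * v j) {..<n} \<le> spectral_norm A * L2_set v {..<n}"
  proof (cases "l = 0")
    case True
    then show ?thesis using r[unfolded op_bound_def, rule_format, of v] by (simp add: l_def)
  next
    case False
    then have l: "l > 0" by (simp add: l_def order_less_le)
    define w where "w = Matrix.vec n (\<lambda>i. v i / l)"
    have w: "w \<in> carrier_vec n" by (simp add: w_def)
    have "euclid_norm w = L2_set (\<lambda>i. 1 / l * v i) {..<n}"
      by (auto simp: euclid_norm_eq_L2_set w_def intro!: L2_set_cong)
    also have "\<dots> = 1" using l by (subst L2_set_right_distrib[symmetric]) (auto simp: l_def)
    finally have "w \<in> ?U" using w A by simp
    then have "euclid_norm (A *\<^sub>v w) \<le> spectral_norm A"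
      unfolding spectral_norm_def by (intro cSUP_upper bdd)
    moreover have "euclid_norm (A *\<^sub>v w) = L2_set (\<lambda>i. 1 / l * (\<Sum>j<n. A $$ (i, j) * v j)) {..<n}"
      by (subst euclid_norm_mult_mat_vec[OF A w], rule L2_set_cong)
         (auto simp: w_def sum_distrib_left intro!: sum.cong)
    moreover have "\<dots> = 1 / l * L2_set (\<lambda>i. \<Sum>j<n. A $$ (i, j) * v j) {..<n}"
      using l by (intro L2_set_right_distrib[symmetric]) auto
    ultimately have "1 / l * L2_set (\<lambda>i. \<Sum>j<n. A $$ (i, j) * v j) {..<n} \<le> spectral_norm A"
      by (simp only:)
    then show ?thesis using l unfolding l_def[symmetric] by (simp add: pos_divide_le_eq)
  qed
qed

lemma spectral_norm_le:
  assumes A: "A \<in> carrier_mat n n" and c: "op_bound n (\<lambda>i j. A $$ (i, j)) c" "c \<ge> 0"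
  shows "spectral_norm A \<le> c"
  unfolding spectral_norm_def
proof (rule cSUP_least)
  have "0\<^sub>v n \<in> {v \<in> carrier_vec (dim_col A). euclid_norm v \<le> 1}"
    using A by (simp add: euclid_norm_def)
  then show "{v \<in> carrier_vec (dim_col A). euclid_norm v \<le> 1} \<noteq> {}" by blast
  fix w assume w: "w \<in> {v \<in> carrier_vec (dim_col A). euclid_norm v \<le> 1}"
  then have "euclid_norm (A *\<^sub>v w) \<le> c * euclid_norm w"
    using A c by (subst euclid_norm_mult_mat_vec[OF A]) (auto simp: op_bound_def euclid_norm_eq_L2_set)
  also have "\<dots> \<le> c * 1" using w c by (intro mult_left_mono) auto
  finally show "euclid_norm (A *\<^sub>v w) \<le> c" by simp
qed

text \<open>Tested on the all-ones vector, of norm sqrt n. In dimension 0 every number is a bound,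
  negative ones included.\<close>

lemma op_bound_nonneg:
  assumes "op_bound n A c" "n > 0" shows "c \<ge> 0"
proof -
  have "0 \<le> L2_set (\<lambda>i. \<Sum>j<n. A i j * 1) {..<n}" by simp
  also have "\<dots> \<le> c * L2_set (\<lambda>_. 1) {..<n}"
    using assms(1) unfolding op_bound_def by (rule spec)
  also have "\<dots> = c * sqrt n" by (simp add: L2_set_constant)
  finally show ?thesis using assms(2) by (simp add: zero_le_mult_iff)
qed

text \<open>The deterministic half of the argument: the Gaussian integrals enter only through the
  estimates on \<open>p\<close>, \<open>q\<close> and \<open>sig\<close>. \<open>B\<close> bounds
  both the operator norm of \<Delta> and the euclidean norm of its diagonal, and the final factor of
  \<open>e\<close> does not involve n.\<close>

lemma op_bound_kernel_error:
  fixes \<Delta> sig :: "nat \<Rightarrow> nat \<Rightarrow> real" and p q :: "real \<Rightarrow> real"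
  defines "d \<equiv> \<lambda>i. \<Delta> i i"
  assumes op: "op_bound n \<Delta> B" "B \<ge> 0" and L2: "L2_set d {..<n} \<le> B"
    and sym: "\<And>i j. i < n \<Longrightarrow> j < n \<Longrightarrow> \<Delta> i j = \<Delta> j i"
    and le: "\<And>i j. i < n \<Longrightarrow> j < n \<Longrightarrow> \<bar>\<Delta> i j\<bar> \<le> e" and e: "0 \<le> e" "e \<le> 1 / 20" and C: "C \<ge> 0"
    and p: "\<And>a. \<bar>a\<bar> \<le> 1 / 5 \<Longrightarrow> \<bar>p a - \<kappa> * a\<bar> \<le> C * a\<^sup>2"
    and q: "\<And>a. \<bar>a\<bar> \<le> 1 / 5 \<Longrightarrow> \<bar>q a - z1\<bar> \<le> C * \<bar>a\<bar>" "\<And>a. \<bar>a\<bar> \<le> 1 / 5 \<Longrightarrow> \<bar>q a\<bar> \<le> C"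
    and diag: "\<And>i. i < n \<Longrightarrow> \<bar>sig i i - h\<bar> \<le> C * e"
    and off: "\<And>i j. i < n \<Longrightarrow> j < n \<Longrightarrow> i \<noteq> j \<Longrightarrow>
      \<bar>sig i j - (p (d i) * p (d j) + q (d i) * q (d j) * \<Delta> i j + z2\<^sup>2 * (\<Delta> i j)\<^sup>2)\<bar> \<le> C * e * (\<Delta> i j)\<^sup>2"
  shows "op_bound n (\<lambda>i j. sig i j - ((if i = j then h else 0) + \<kappa>\<^sup>2 * d i * d j
        + z1\<^sup>2 * \<Delta> i j + z2\<^sup>2 * (\<Delta> i j)\<^sup>2 + z3\<^sup>2 * (\<Delta> i j) ^ 3))
      (((\<bar>\<kappa>\<bar> + C) * B * (C * B) + \<bar>\<kappa>\<bar> * B * (C * B) + (C * C + \<bar>z1\<bar> * C) * B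
        + (C + (\<bar>\<kappa>\<bar> + C)\<^sup>2 + C\<^sup>2 + z2\<^sup>2 + z3\<^sup>2) * (B\<^sup>2 + 1)) * e)"
proof -
  define C1 where "C1 = C + (\<bar>\<kappa>\<bar> + C)\<^sup>2 + C\<^sup>2 + z2\<^sup>2 + z3\<^sup>2"
  have C1: "C1 \<ge> 0" "C + z3\<^sup>2 \<le> C1" using C by (auto simp: C1_def)
  have e1: "e \<le> 1" using e by simp
  have d: "\<bar>d i\<bar> \<le> e" "\<bar>d i\<bar> \<le> 1 / 5" if "i < n" for i
    using le[OF that that] e by (auto simp: d_def)
  have sq: "(\<Delta> i j)\<^sup>2 \<le> e" if "i < n" "j < n" for i j
  proof -
    have "\<bar>\<Delta> i j\<bar>\<^sup>2 \<le> e\<^sup>2" using le[OF that] by (intro power_mono) auto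
    also have "\<dots> \<le> e" using mult_left_mono[OF e1 e(1)] by (simp add: power2_eq_square)
    finally show ?thesis by simp
  qed
  \<comment> \<open>One factor |d i| of the quadratic error is spent to gain \<open>e\<close>. The
    other is kept, so that the euclidean norm of this error vector is of order \<open>e\<close>
    whatever n is.\<close>
  have pd: "\<bar>p (d i) - \<kappa> * d i\<bar> \<le> C * e * \<bar>d i\<bar>" if "i < n" for i
  proof -
    have "(d i)\<^sup>2 = \<bar>d i\<bar> * \<bar>d i\<bar>" by (simp add: power2_eq_square)
    also have "\<dots> \<le> e * \<bar>d i\<bar>" using d[OF that] by (intro mult_right_mono) auto
    finally have "C * (d i)\<^sup>2 \<le> C * (e * \<bar>d i\<bar>)" using C by (rule mult_left_mono)
    then show ?thesis using p[OF d(2)[OF that]] by simp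
  qed
  have pd': "\<bar>p (d i)\<bar> \<le> (\<bar>\<kappa>\<bar> + C) * \<bar>d i\<bar>" if "i < n" for i
  proof -
    have "C * e * \<bar>d i\<bar> \<le> C * 1 * \<bar>d i\<bar>" using C e1 by (intro mult_right_mono mult_left_mono) auto
    then have "\<bar>p (d i)\<bar> \<le> \<bar>\<kappa> * d i\<bar> + C * \<bar>d i\<bar>" using pd[OF that] by simp
    then show ?thesis by (simp add: abs_mult distrib_right)
  qed
  have dom: "L2_set g {..<n} \<le> k * B" if "\<And>i. i < n \<Longrightarrow> \<bar>g i\<bar> \<le> k * \<bar>d i\<bar>" "k \<ge> 0" for g k
  proof -
    have "L2_set g {..<n} = L2_set (\<lambda>i. \<bar>g i\<bar>) {..<n}" by (simp only: L2_set_abs)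
    also have "\<dots> \<le> L2_set (\<lambda>i. k * \<bar>d i\<bar>) {..<n}" using that by (intro L2_set_mono) auto
    also have "\<dots> = k * L2_set d {..<n}" by (simp only: L2_set_right_distrib[OF that(2), symmetric] L2_set_abs)
    also have "\<dots> \<le> k * B" using L2 that(2) by (rule mult_left_mono)
    finally show ?thesis .
  qed
  have Lp: "L2_set (\<lambda>i. p (d i)) {..<n} \<le> (\<bar>\<kappa>\<bar> + C) * B" using pd' C by (intro dom) auto
  have Ldiff: "L2_set (\<lambda>i. p (d i) - \<kappa> * d i) {..<n} \<le> C * e * B" using pd C e by (intro dom) auto
  have Ld: "L2_set (\<lambda>i. \<kappa> * d i) {..<n} \<le> \<bar>\<kappa>\<bar> * B" by (intro dom) (auto simp: abs_mult)
  have 1: "op_bound n (\<lambda>i j. (p (d i) - \<kappa> * d i) * p (d j)) ((C * e * B) * ((\<bar>\<kappa>\<bar> + C) * B))"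
    using C e op(2) by (intro op_bound_mono[OF op_bound_rank_one] mult_mono Lp Ldiff) auto
  have 2: "op_bound n (\<lambda>i j. (\<kappa> * d i) * (p (d j) - \<kappa> * d j)) ((\<bar>\<kappa>\<bar> * B) * (C * e * B))"
    using C e op(2) by (intro op_bound_mono[OF op_bound_rank_one] mult_mono Ld Ldiff) auto
  have qd: "\<bar>q (d i) - z1\<bar> \<le> C * e" if "i < n" for i
    by (rule order_trans[OF q(1)[OF d(2)[OF that]]]) (use C d(1)[OF that] in \<open>auto intro: mult_left_mono\<close>)
  have 3: "op_bound n (\<lambda>i j. (q (d i) - z1) * q (d j) * \<Delta> i j) (C * e * C * B)"
    using C e op qd q(2) d(2) by (intro op_bound_diag_scaling) auto
  have 4: "op_bound n (\<lambda>i j. z1 * (q (d j) - z1) * \<Delta> i j) (\<bar>z1\<bar> * (C * e) * B)"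
    using C e op qd by (intro op_bound_diag_scaling[where a = "\<lambda>_. z1"]) auto
  \<comment> \<open>The residual before \<open>p\<close> and \<open>q\<close> are replaced by their
    leading terms.\<close>
  define G where "G = (\<lambda>i j. sig i j - ((if i = j then h else 0) + p (d i) * p (d j)
      + q (d i) * q (d j) * \<Delta> i j + z2\<^sup>2 * (\<Delta> i j)\<^sup>2 + z3\<^sup>2 * (\<Delta> i j) ^ 3))"
  have cube: "\<bar>z3\<^sup>2 * (\<Delta> i j) ^ 3\<bar> \<le> z3\<^sup>2 * e * (\<Delta> i j)\<^sup>2" if "i < n" "j < n" for i j
  proof -
    have "\<bar>(\<Delta> i j) ^ 3\<bar> = \<bar>\<Delta> i j\<bar> * (\<Delta> i j)\<^sup>2" by (simp add: power_abs eval_nat_numeral abs_mult)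
    also have "\<dots> \<le> e * (\<Delta> i j)\<^sup>2" using le[OF that] by (intro mult_right_mono) auto
    finally have "z3\<^sup>2 * \<bar>(\<Delta> i j) ^ 3\<bar> \<le> z3\<^sup>2 * (e * (\<Delta> i j)\<^sup>2)" by (intro mult_left_mono) auto
    then show ?thesis by (simp add: abs_mult)
  qed
  have G: "\<bar>G i j\<bar> \<le> C1 * e * ((\<Delta> i j)\<^sup>2 + (if i = j then 1 else 0))" if ij: "i < n" "j < n" for i j
  proof (cases "i = j")
    case False
    have "\<bar>G i j\<bar> \<le> C * e * (\<Delta> i j)\<^sup>2 + z3\<^sup>2 * e * (\<Delta> i j)\<^sup>2"
      using off[OF ij False] cube[OF ij] False unfolding G_def by simp
    also have "\<dots> = (C + z3\<^sup>2) * (e * (\<Delta> i j)\<^sup>2)" by (simp add: algebra_simps)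
    also have "\<dots> \<le> C1 * (e * (\<Delta> i j)\<^sup>2)" using C1 e by (intro mult_right_mono) auto
    finally show ?thesis using False by simp
  next
    \<comment> \<open>No cancellation is sought on the diagonal: beyond the comparison of
      \<open>sig i i\<close> with \<open>h\<close>, each term is of order \<open>e\<close> by
      itself.\<close>
    case True
    have tri: "\<bar>s - (h' + u + v + w + x)\<bar> \<le> \<bar>s - h'\<bar> + \<bar>u\<bar> + \<bar>v\<bar> + \<bar>w\<bar> + \<bar>x\<bar>"
      for s h' u v w x :: real by linarith
    have "\<bar>p (d i) * p (d i)\<bar> \<le> (\<bar>\<kappa>\<bar> + C)\<^sup>2 * e"
    proof -
      have "\<bar>p (d i)\<bar>\<^sup>2 \<le> ((\<bar>\<kappa>\<bar> + C) * \<bar>d i\<bar>)\<^sup>2" using pd'[OF ij(1)] by (intro power_mono) auto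
      also have "\<dots> = (\<bar>\<kappa>\<bar> + C)\<^sup>2 * (\<Delta> i i)\<^sup>2" by (simp add: power_mult_distrib d_def)
      also have "\<dots> \<le> (\<bar>\<kappa>\<bar> + C)\<^sup>2 * e" using sq[OF ij(1,1)] by (intro mult_left_mono) auto
      finally show ?thesis by (simp add: power2_eq_square)
    qed
    moreover have "\<bar>q (d i) * q (d i) * \<Delta> i i\<bar> \<le> C\<^sup>2 * e"
      unfolding abs_mult power2_eq_square
      using q(2)[OF d(2)[OF ij(1)]] le[OF ij(1,1)] C by (intro mult_mono) auto
    moreover have "\<bar>z2\<^sup>2 * (\<Delta> i i)\<^sup>2\<bar> \<le> z2\<^sup>2 * e"
      using sq[OF ij(1,1)] by (simp add: abs_mult mult_left_mono)
    moreover have "\<bar>z3\<^sup>2 * (\<Delta> i i) ^ 3\<bar> \<le> z3\<^sup>2 * e"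
    proof -
      have "z3\<^sup>2 * e * (\<Delta> i i)\<^sup>2 \<le> z3\<^sup>2 * e * 1"
        using e1 sq[OF ij(1,1)] e by (intro mult_left_mono) auto
      then show ?thesis using cube[OF ij(1,1)] by simp
    qed
    ultimately have "\<bar>G i i\<bar> \<le> C * e + (\<bar>\<kappa>\<bar> + C)\<^sup>2 * e + C\<^sup>2 * e + z2\<^sup>2 * e + z3\<^sup>2 * e"
      using diag[OF ij(1)] tri[of "sig i i" h "p (d i) * p (d i)" "q (d i) * q (d i) * \<Delta> i i"
          "z2\<^sup>2 * (\<Delta> i i)\<^sup>2" "z3\<^sup>2 * (\<Delta> i i) ^ 3"]
      unfolding G_def simp_thms if_True by linarith
    also have "\<dots> = C1 * e" by (simp add: C1_def algebra_simps)
    also have "\<dots> \<le> C1 * e * ((\<Delta> i i)\<^sup>2 + 1)" using C1 e by (simp add: distrib_left)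
    finally show ?thesis using True by simp
  qed
  \<comment> \<open>The squared entries are controlled along columns, through unit vectors; symmetry
    carries this over to rows.\<close>
  have row: "(\<Sum>j<n. C1 * e * ((\<Delta> i j)\<^sup>2 + (if i = j then 1 else 0))) \<le> C1 * e * (B\<^sup>2 + 1)"
    if i: "i < n" for i
  proof -
    have "(\<Sum>j<n. (\<Delta> i j)\<^sup>2) = (\<Sum>j<n. (\<Delta> j i)\<^sup>2)" using sym[OF i] by (intro sum.cong) auto
    also have "\<dots> \<le> B\<^sup>2" by (rule op_bound_column[OF op(1) i])
    finally have "(\<Sum>j<n. (\<Delta> i j)\<^sup>2 + (if i = j then 1 else 0)) \<le> B\<^sup>2 + 1"
      using i by (simp add: sum.distrib)
    then show ?thesis unfolding sum_distrib_left[symmetric] using C1 e by (intro mult_left_mono) auto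
  qed
  have 5: "op_bound n G (C1 * e * (B\<^sup>2 + 1))"
  proof (rule op_bound_Schur_test)
    show "(\<Sum>j<n. \<bar>G i j\<bar>) \<le> C1 * e * (B\<^sup>2 + 1)" if "i < n" for i
      by (rule order_trans[OF sum_mono row[OF that]]) (use G that in auto)
    show "(\<Sum>i<n. \<bar>G i j\<bar>) \<le> C1 * e * (B\<^sup>2 + 1)" if "j < n" for j
    proof (rule order_trans[OF sum_mono row[OF that]])
      fix i assume "i \<in> {..<n}"
      then show "\<bar>G i j\<bar> \<le> C1 * e * ((\<Delta> j i)\<^sup>2 + (if j = i then 1 else 0))"
        using G[of i j] sym[of i j] that by (auto split: if_splits)
    qed
    show "0 \<le> C1 * e * (B\<^sup>2 + 1)" using C1 e by simp
  qed
  \<comment> \<open>The first two terms telescope to p p - \<kappa>^2 d d and the next two to (q q -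
    z1^2) \<Delta>, so adding \<open>G\<close> exchanges \<open>p\<close> and \<open>q\<close> for
    their leading terms.\<close>
  have "op_bound n (\<lambda>i j. (p (d i) - \<kappa> * d i) * p (d j) + (\<kappa> * d i) * (p (d j) - \<kappa> * d j)
      + (q (d i) - z1) * q (d j) * \<Delta> i j + z1 * (q (d j) - z1) * \<Delta> i j + G i j)
    ((C * e * B) * ((\<bar>\<kappa>\<bar> + C) * B) + (\<bar>\<kappa>\<bar> * B) * (C * e * B) + C * e * C * B + \<bar>z1\<bar> * (C * e) * B
      + C1 * e * (B\<^sup>2 + 1))"
    by (intro op_bound_add 1 2 3 4 5)
  also have "(\<lambda>i j. (p (d i) - \<kappa> * d i) * p (d j) + (\<kappa> * d i) * (p (d j) - \<kappa> * d j)
      + (q (d i) - z1) * q (d j) * \<Delta> i j + z1 * (q (d j) - z1) * \<Delta> i j + G i j)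
    = (\<lambda>i j. sig i j - ((if i = j then h else 0) + \<kappa>\<^sup>2 * d i * d j
        + z1\<^sup>2 * \<Delta> i j + z2\<^sup>2 * (\<Delta> i j)\<^sup>2 + z3\<^sup>2 * (\<Delta> i j) ^ 3))"
    by (intro ext) (simp add: G_def algebra_simps power2_eq_square)
  also have "(C * e * B) * ((\<bar>\<kappa>\<bar> + C) * B) + (\<bar>\<kappa>\<bar> * B) * (C * e * B) + C * e * C * B + \<bar>z1\<bar> * (C * e) * B
      + C1 * e * (B\<^sup>2 + 1) = ((\<bar>\<kappa>\<bar> + C) * B * (C * B) + \<bar>\<kappa>\<bar> * B * (C * B) + (C * C + \<bar>z1\<bar> * C) * B
        + C1 * (B\<^sup>2 + 1)) * e"
    by (simp add: algebra_simps)
  finally show ?thesis unfolding C1_def .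
qed

subsection \<open>The error of the approximation\<close>

lemma diag_vec_index: "A \<in> carrier_mat n n \<Longrightarrow> i < n \<Longrightarrow> diag_vec A $ i = A $$ (i, i)"
  by (simp add: diag_vec_def vec_of_list_index diag_mat_def)

lemma dim_diag_vec: "A \<in> carrier_mat n n \<Longrightarrow> dim_vec (diag_vec A) = n"
  by (simp add: diag_vec_def diag_mat_def)

lemma euclid_norm_diag_vec:
  assumes "A \<in> carrier_mat n n"
  shows "euclid_norm (diag_vec A) = L2_set (\<lambda>i. A $$ (i, i)) {..<n}"
  unfolding euclid_norm_eq_L2_set dim_diag_vec[OF assms]
  by (rule L2_set_cong) (simp_all add: diag_vec_index[OF assms])

lemma abs_le_max_norm:
  assumes "A \<in> carrier_mat n n" "i < n" "j < n"
  shows "\<bar>A $$ (i, j)\<bar> \<le> max_norm A"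
  unfolding max_norm_def
proof (rule Max_ge)
  show "finite (abs ` elements_mat A)" by (simp add: elements_mat_def)
  show "\<bar>A $$ (i, j)\<bar> \<in> abs ` elements_mat A" using assms by (intro imageI elements_matI) auto
qed

lemma Sigma_approx_carrier:
  assumes D: "D \<in> carrier_mat n n"
  shows "Sigma_approx f n D \<in> carrier_mat n n"
  using D by (simp add: Sigma_approx_def outer_prod_def hadamard_power_def dim_diag_vec[OF D])

lemma Sigma_approx_index:
  assumes D: "D \<in> carrier_mat n n" and ij: "i < n" "j < n"
  shows "Sigma_approx f n D $$ (i, j) = (if i = j then (H_norm f)\<^sup>2 else 0)
    + (zeta 2 f / sqrt 2)\<^sup>2 * D $$ (i, i) * D $$ (j, j)
    + (zeta 1 f)\<^sup>2 * D $$ (i, j) + (zeta 2 f)\<^sup>2 * (D $$ (i, j))\<^sup>2 + (zeta 3 f)\<^sup>2 * (D $$ (i, j)) ^ 3"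
  using D ij
  by (simp add: Sigma_approx_def outer_prod_def hadamard_power_def dim_diag_vec[OF D]
      diag_vec_index[OF D] power_divide)

text \<open>The constant of the deterministic bound, for a \<open>C\<close> dominating every
  constant of the Gaussian estimates. Some of these are linear and some quadratic in
  \<open>K\<close>, whence K + K^2. The dimension does not occur.\<close>

definition kernel_error_const :: "(real \<Rightarrow> real) \<Rightarrow> real \<Rightarrow> real \<Rightarrow> real" where
  "kernel_error_const f K B =
     (let C = 2 ^ 50 * (K + K\<^sup>2); \<kappa> = zeta 2 f / sqrt 2 in
      (\<bar>\<kappa>\<bar> + C) * B * (C * B) + \<bar>\<kappa>\<bar> * B * (C * B) + (C * C + \<bar>zeta 1 f\<bar> * C) * B
        + (C + (\<bar>\<kappa>\<bar> + C)\<^sup>2 + C\<^sup>2 + (zeta 2 f)\<^sup>2 + (zeta 3 f)\<^sup>2) * (B\<^sup>2 + 1))"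

lemma kernel_error_const_nonneg: "0 \<le> K \<Longrightarrow> 0 \<le> B \<Longrightarrow> 0 \<le> kernel_error_const f K B"
  by (simp add: kernel_error_const_def Let_def)

context lipschitz_fun
begin

text \<open>The asymptotic claim at a single dimension, with a constant uniform in n. Positivity of
  n keeps \<open>max_norm\<close> meaningful and makes the bounds nonnegative.\<close>

lemma gaussian_vector_kernel_error:
  assumes gv: "gaussian_vector M n u" and mean: "mean_vec M n u = 0\<^sub>v n"
    and D: "D = covariance_mat M n u - 1\<^sub>m n" and z0: "zeta 0 f = 0"
    and B: "spectral_norm D \<le> B" "euclid_norm (diag_vec D) \<le> B" "B \<ge> 0"
    and e: "max_norm D \<le> 1 / 20" and n: "n > 0"
  shows "\<bar>spectral_norm (second_moment_mat M n (\<lambda>\<omega>. map_vec f (u \<omega>)) - Sigma_approx f n D)\<bar>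
    \<le> kernel_error_const f K B * max_norm D"
proof -
  define C where "C = 2 ^ 50 * (K + K\<^sup>2)"
  define \<kappa> where "\<kappa> = zeta 2 f / sqrt 2"
  have const: "kernel_error_const f K B = ((\<bar>\<kappa>\<bar> + C) * B * (C * B) + \<bar>\<kappa>\<bar> * B * (C * B) + (C * C + \<bar>zeta 1 f\<bar> * C) * B
        + (C + (\<bar>\<kappa>\<bar> + C)\<^sup>2 + C\<^sup>2 + (zeta 2 f)\<^sup>2 + (zeta 3 f)\<^sup>2) * (B\<^sup>2 + 1))"
    by (simp add: kernel_error_const_def C_def \<kappa>_def Let_def)
  have M: "prob_space M" using gv by (simp add: gaussian_vector_def)
  have carr: "u \<omega> \<in> carrier_vec n" if "\<omega> \<in> space M" for \<omega>
    using gv that by (simp add: gaussian_vector_def)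
  define U where "U = (\<lambda>i \<omega>. u \<omega> $ i)"
  have gv1: "gaussian_variable M (\<lambda>\<omega>. c \<bullet> u \<omega>)" if "c \<in> carrier_vec n" for c
    using gv that by (simp add: gaussian_vector_def)
  have G: "gaussian_variable M (\<lambda>\<omega>. a * U i \<omega> + b * U j \<omega>)" if ij: "i < n" "j < n" for i j a b
  proof -
    \<comment> \<open>The test vector that extracts two coordinates. For i = j its coefficients
      simply add up.\<close>
    define c where "c = a \<cdot>\<^sub>v unit_vec n i + b \<cdot>\<^sub>v unit_vec n j"
    have "c \<bullet> u \<omega> = a * U i \<omega> + b * U j \<omega>" if "\<omega> \<in> space M" for \<omega>
      using carr[OF that] ij
      by (simp add: c_def U_def add_scalar_prod_distrib[where n = n] scalar_prod_left_unit)
    moreover have "gaussian_variable M (\<lambda>\<omega>. c \<bullet> u \<omega>)" by (rule gv1) (simp add: c_def)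
    ultimately show ?thesis using gaussian_variable_cong[of M "\<lambda>\<omega>. c \<bullet> u \<omega>"] by simp
  qed
  have dimS: "covariance_mat M n u \<in> carrier_mat n n"
    by (simp add: covariance_mat_def second_moment_mat_def)
  have Dc: "D \<in> carrier_mat n n" unfolding D by (rule minus_carrier_mat) simp
  have EU: "(\<integral>\<omega>. U i \<omega> \<partial>M) = 0" if "i < n" for i
    using arg_cong[OF mean, of "\<lambda>v. v $ i"] that by (simp add: mean_vec_def U_def)
  have S: "D $$ (i, j) = (\<integral>\<omega>. U i \<omega> * U j \<omega> \<partial>M) - (if i = j then 1 else 0)" if "i < n" "j < n" for i j
  proof -
    have "covariance_mat M n u $$ (i, j) = (\<integral>\<omega>. (u \<omega> - 0\<^sub>v n) $ i * (u \<omega> - 0\<^sub>v n) $ j \<partial>M)"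
      using that by (simp add: covariance_mat_def second_moment_mat_def mean)
    also have "\<dots> = (\<integral>\<omega>. U i \<omega> * U j \<omega> \<partial>M)"
      using that carr by (intro Bochner_Integration.integral_cong) (auto simp: U_def)
    finally show ?thesis using that dimS by (simp add: D)
  qed
  have var: "(\<integral>\<omega>. (U i \<omega>)\<^sup>2 \<partial>M) = 1 + D $$ (i, i)" if "i < n" for i
    using S[OF that that] by (simp add: power2_eq_square)
  have De: "\<bar>D $$ (i, j)\<bar> \<le> max_norm D" if "i < n" "j < n" for i j
    using abs_le_max_norm[OF Dc that] .
  have e0: "0 \<le> max_norm D" using De[OF n n] by simp
  have K: "0 \<le> K" "0 \<le> K\<^sup>2" by (simp_all add: K_nonneg)
  have C': "0 \<le> C" "2 ^ 18 * K \<le> C" "2 ^ 16 * K \<le> C" "2 ^ 15 * K \<le> C" "2048 * K\<^sup>2 \<le> C" "2 ^ 50 * K\<^sup>2 \<le> C"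
    using K by (simp_all add: C_def)
  define sig where "sig = (\<lambda>i j. \<integral>\<omega>. f (U i \<omega>) * f (U j \<omega>) \<partial>M)"
  have opD: "op_bound n (\<lambda>i j. D $$ (i, j)) B"
    using op_bound_spectral_norm[OF Dc] B(1) by (rule op_bound_mono)
  have "op_bound n (\<lambda>i j. sig i j - ((if i = j then (H_norm f)\<^sup>2 else 0) + \<kappa>\<^sup>2 * D $$ (i, i) * D $$ (j, j)
        + (zeta 1 f)\<^sup>2 * D $$ (i, j) + (zeta 2 f)\<^sup>2 * (D $$ (i, j))\<^sup>2 + (zeta 3 f)\<^sup>2 * (D $$ (i, j)) ^ 3))
      (((\<bar>\<kappa>\<bar> + C) * B * (C * B) + \<bar>\<kappa>\<bar> * B * (C * B) + (C * C + \<bar>zeta 1 f\<bar> * C) * B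
        + (C + (\<bar>\<kappa>\<bar> + C)\<^sup>2 + C\<^sup>2 + (zeta 2 f)\<^sup>2 + (zeta 3 f)\<^sup>2) * (B\<^sup>2 + 1)) * max_norm D)"
  proof (rule op_bound_kernel_error[OF opD B(3) _ _ _ e0 e C'(1)])
    show "L2_set (\<lambda>i. D $$ (i, i)) {..<n} \<le> B"
      using B(2) euclid_norm_diag_vec[OF Dc] by simp
    show "D $$ (i, j) = D $$ (j, i)" if "i < n" "j < n" for i j
      using S[OF that] S[OF that(2,1)] by (simp add: mult.commute)
    show "\<bar>D $$ (i, j)\<bar> \<le> max_norm D" if "i < n" "j < n" for i j by (rule De[OF that])
    fix a :: real assume a: "\<bar>a\<bar> \<le> 1 / 5"
    show "\<bar>coeff0 f a - \<kappa> * a\<bar> \<le> C * a\<^sup>2"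
      using coeff0_expansion[OF z0 a] mult_right_mono[OF C'(2), of "a\<^sup>2"] by (simp add: \<kappa>_def)
    show "\<bar>coeff1 f a - zeta 1 f\<bar> \<le> C * \<bar>a\<bar>"
      using coeff1_lipschitz[OF a] mult_right_mono[OF C'(3), of "\<bar>a\<bar>"] by simp
    show "\<bar>coeff1 f a\<bar> \<le> C" using coeff1_bound[OF a] C'(4) by simp
  next
    fix i assume i: "i < n"
    have "\<bar>(\<integral>\<omega>. (f (U i \<omega>))\<^sup>2 \<partial>M) - (H_norm f)\<^sup>2\<bar> \<le> 2048 * K\<^sup>2 * \<bar>D $$ (i, i)\<bar>"
      \<comment> \<open>Equal indices and second coefficient 0 give the multiples of a single
        coordinate.\<close>
      using G[OF i i, of _ 0] EU[OF i] var[OF i] De[OF i i] e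
      by (intro gaussian_square_expectation[OF M]) auto
    also have "\<dots> \<le> C * max_norm D" using C' De[OF i i] by (intro mult_mono) auto
    finally show "\<bar>sig i i - (H_norm f)\<^sup>2\<bar> \<le> C * max_norm D" by (simp add: sig_def power2_eq_square)
  next
    fix i j assume ij: "i < n" "j < n" "i \<noteq> j"
    have "(\<integral>\<omega>. U i \<omega> * U j \<omega> \<partial>M) = D $$ (i, j)" using S[OF ij(1,2)] ij(3) by simp
    note gaussian_pair_covariance_expansion[OF M G[OF ij(1,2)] EU[OF ij(1)] EU[OF ij(2)] var[OF ij(1)] var[OF ij(2)]
        this De[OF ij(1,1)] De[OF ij(2,2)] De[OF ij(1,2)] e]
    also have "2 ^ 50 * K\<^sup>2 * max_norm D * (D $$ (i, j))\<^sup>2 \<le> C * max_norm D * (D $$ (i, j))\<^sup>2"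
      using C'(6) e0 by (intro mult_right_mono) auto
    finally show "\<bar>sig i j - (coeff0 f (D $$ (i, i)) * coeff0 f (D $$ (j, j))
          + coeff1 f (D $$ (i, i)) * coeff1 f (D $$ (j, j)) * D $$ (i, j) + (zeta 2 f)\<^sup>2 * (D $$ (i, j))\<^sup>2)\<bar>
        \<le> C * max_norm D * (D $$ (i, j))\<^sup>2"
      unfolding sig_def .
  qed
  moreover define E where "E = second_moment_mat M n (\<lambda>\<omega>. map_vec f (u \<omega>)) - Sigma_approx f n D"
  have Ec: "E \<in> carrier_mat n n" unfolding E_def by (rule minus_carrier_mat) (rule Sigma_approx_carrier[OF Dc])
  have Eij: "E $$ (i, j) = sig i j - ((if i = j then (H_norm f)\<^sup>2 else 0) + \<kappa>\<^sup>2 * D $$ (i, i) * D $$ (j, j)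
        + (zeta 1 f)\<^sup>2 * D $$ (i, j) + (zeta 2 f)\<^sup>2 * (D $$ (i, j))\<^sup>2 + (zeta 3 f)\<^sup>2 * (D $$ (i, j)) ^ 3)"
    if "i < n" "j < n" for i j
  proof -
    have "second_moment_mat M n (\<lambda>\<omega>. map_vec f (u \<omega>)) $$ (i, j)
        = (\<integral>\<omega>. map_vec f (u \<omega>) $ i * map_vec f (u \<omega>) $ j \<partial>M)"
      using that by (simp add: second_moment_mat_def)
    also have "\<dots> = sig i j"
      unfolding sig_def using that carr[THEN carrier_vecD]
      by (intro Bochner_Integration.integral_cong) (auto simp: U_def)
    finally show ?thesis
      using that Sigma_approx_carrier[OF Dc, of f] unfolding E_def \<kappa>_def by (simp add: Sigma_approx_index[OF Dc that])
  qed
  ultimately have op: "op_bound n (\<lambda>i j. E $$ (i, j))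
      (((\<bar>\<kappa>\<bar> + C) * B * (C * B) + \<bar>\<kappa>\<bar> * B * (C * B) + (C * C + \<bar>zeta 1 f\<bar> * C) * B
        + (C + (\<bar>\<kappa>\<bar> + C)\<^sup>2 + C\<^sup>2 + (zeta 2 f)\<^sup>2 + (zeta 3 f)\<^sup>2) * (B\<^sup>2 + 1)) * max_norm D)"
    by (subst op_bound_cong[OF Eij])
  have "0 \<le> spectral_norm E" using op_bound_spectral_norm[OF Ec] n by (rule op_bound_nonneg)
  then show ?thesis
    using spectral_norm_le[OF Ec op op_bound_nonneg[OF op n]] unfolding E_def const by simp
qed

end

theorem theorem3p9:
  fixes f :: "real \<Rightarrow> real"
    and M :: "nat \<Rightarrow> 'a measure"
    and u y :: "nat \<Rightarrow> 'a \<Rightarrow> real Matrix.vec"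
    and S \<Sigma> \<Delta> :: "nat \<Rightarrow> real Matrix.mat"
  assumes lipschitz: "\<exists>L. L-lipschitz_on UNIV f"
    and zeta_0: "zeta 0 f = 0"
    and gaussian: "\<And>n. gaussian_vector (M n) n (u n)"
    and centered: "\<And>n. mean_vec (M n) n (u n) = 0\<^sub>v n"
    and covariance: "\<And>n. S n = covariance_mat (M n) n (u n)"
    and y: "\<And>n \<omega>. y n \<omega> = map_vec f (u n \<omega>)"
    and Sigma: "\<And>n. \<Sigma> n = second_moment_mat (M n) n (y n)"
    and Delta: "\<And>n. \<Delta> n = S n - 1\<^sub>m n"
    and bounded_spectral: "Bseq (\<lambda>n. spectral_norm (\<Delta> n))"
    and bounded_diag: "Bseq (\<lambda>n. euclid_norm (diag_vec (\<Delta> n)))"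
    and max_tendsto_0: "(\<lambda>n. max_norm (\<Delta> n)) \<longlonglongrightarrow> 0"
  shows "(\<lambda>n. spectral_norm (\<Sigma> n - Sigma_approx f n (\<Delta> n))) \<in> O(\<lambda>n. max_norm (\<Delta> n))"
proof -
  obtain L where L: "L-lipschitz_on UNIV f" using lipschitz by blast
  \<comment> \<open>Adding |f 0| to the Lipschitz constant satisfies both locale conditions at
    once.\<close>
  interpret lipschitz_fun f "L + \<bar>f 0\<bar>"
  proof
    have L0: "L \<ge> 0" using L by (rule lipschitz_on_nonneg)
    show "\<bar>f x - f y\<bar> \<le> (L + \<bar>f 0\<bar>) * \<bar>x - y\<bar>" for x y
    proof -
      have "\<bar>f x - f y\<bar> \<le> L * \<bar>x - y\<bar>"
        using lipschitz_onD[OF L, of x y] by (simp add: dist_real_def)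
      also have "\<dots> \<le> (L + \<bar>f 0\<bar>) * \<bar>x - y\<bar>" by (intro mult_right_mono) auto
      finally show ?thesis .
    qed
    show "\<bar>f 0\<bar> \<le> L + \<bar>f 0\<bar>" using L0 by simp
  qed
  obtain B1 where B1: "\<And>n. norm (spectral_norm (\<Delta> n)) \<le> B1"
    using bounded_spectral by (auto simp: Bseq_def)
  obtain B2 where B2: "\<And>n. norm (euclid_norm (diag_vec (\<Delta> n))) \<le> B2"
    using bounded_diag by (auto simp: Bseq_def)
  define B where "B = max B1 B2"
  have B: "spectral_norm (\<Delta> n) \<le> B" "euclid_norm (diag_vec (\<Delta> n)) \<le> B" "0 \<le> B" for n
    using B1[of n] B2[of n] by (auto simp: B_def)
  \<comment> \<open>The smallness needed by the expansions and the exclusion of the empty matrix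
    hold only from some n on, which suffices for a bound as n tends to infinity.\<close>
  have "eventually (\<lambda>n. max_norm (\<Delta> n) < 1 / 20) sequentially"
    using max_tendsto_0 by (rule order_tendstoD) simp
  moreover have "eventually (\<lambda>n::nat. n > 0) sequentially" by (rule eventually_gt_at_top)
  ultimately have "eventually (\<lambda>n. norm (spectral_norm (\<Sigma> n - Sigma_approx f n (\<Delta> n)))
    \<le> kernel_error_const f (L + \<bar>f 0\<bar>) B * norm (max_norm (\<Delta> n))) sequentially"
  proof eventually_elim
    case (elim n)
    have "\<bar>spectral_norm (second_moment_mat (M n) n (\<lambda>\<omega>. map_vec f (u n \<omega>)) - Sigma_approx f n (\<Delta> n))\<bar>
        \<le> kernel_error_const f (L + \<bar>f 0\<bar>) B * max_norm (\<Delta> n)"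
      using elim by (intro gaussian_vector_kernel_error[OF gaussian centered _ zeta_0 B]) (auto simp: Delta covariance)
    also have "second_moment_mat (M n) n (\<lambda>\<omega>. map_vec f (u n \<omega>)) = \<Sigma> n"
      unfolding Sigma by (simp add: y second_moment_mat_def)
    also have "kernel_error_const f (L + \<bar>f 0\<bar>) B * max_norm (\<Delta> n)
        \<le> kernel_error_const f (L + \<bar>f 0\<bar>) B * norm (max_norm (\<Delta> n))"
      using kernel_error_const_nonneg[OF K_nonneg B(3)] by (intro mult_left_mono) auto
    finally show ?case by simp
  qed
  then show ?thesis by (rule bigoI)
qed

end
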